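(* $\mathrm{achr}(K_6\square K_7)=18$.
   Context: All graphs are finite and simple. $K_n$ denotes the complete graph on $n$ vertices. For graphs $G$ and $H$, $G\square H$ denotes their Cartesian product. In particular, $V(K_p\square K_q)=V(K_p)\times V(K_q)$, and $E(K_p\square K_q)$ consists of all edges $(x,y_1)(x,y_2)$ with $y_1\neq y_2$ and all edges $(x_1,y)(x_2,y)$ with $x_1\neq x_2$. For a finite colour set $C$, a vertex colouring $f:V(G)\to C$ is proper if adjacent vertices receive distinct colours. It is complete if for any two distinct colours $c_1,c_2\in C$ there is an edge $\{v_1,v_2\}\in E(G)$ such that $f(v_1)=c_1$ and $f(v_2)=c_2$. The achromatic number $\mathrm{achr}(G)$ is the maximum cardinality of a finite set $C$ for which there exists a proper complete vertex colouring $f:V(G)\to C$. *)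

theory Defs
  imports "Graph_Theory.Graph_Theory"
begin

text \<open>
  A finite simple graph is a \<^term>\<open>G :: 'a pair_pre_digraph\<close> with \<^prop>\<open>pair_graph G\<close>: its
  vertex set is finite and \<^term>\<open>parcs G\<close> is a symmetric irreflexive relation on it, in which
  an edge between \<open>u\<close> and \<open>v\<close> appears as the two arcs \<open>(u, v)\<close> and \<open>(v, u)\<close>.
\<close>

definition complete_graph :: "nat \<Rightarrow> nat pair_pre_digraph" where
  "complete_graph n =
     \<lparr>pverts = {..<n}, parcs = {(u, v). u \<in> {..<n} \<and> v \<in> {..<n} \<and> u \<noteq> v}\<rparr>"

definition cartesian_product ::
  "'a pair_pre_digraph \<Rightarrow> 'b pair_pre_digraph \<Rightarrow> ('a \<times> 'b) pair_pre_digraph"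
  (infixr \<open>\<box>\<close> 75) where
  "G \<box> H =
     \<lparr>pverts = pverts G \<times> pverts H,
      parcs = {((x, y1), (x, y2)) | x y1 y2. x \<in> pverts G \<and> (y1, y2) \<in> parcs H}
            \<union> {((x1, y), (x2, y)) | x1 x2 y. (x1, x2) \<in> parcs G \<and> y \<in> pverts H}\<rparr>"

definition proper_colouring :: "'a pair_pre_digraph \<Rightarrow> ('a \<Rightarrow> 'c) \<Rightarrow> bool" where
  "proper_colouring G f \<longleftrightarrow> (\<forall>(u, v) \<in> parcs G. f u \<noteq> f v)"

definition complete_colouring :: "'a pair_pre_digraph \<Rightarrow> 'c set \<Rightarrow> ('a \<Rightarrow> 'c) \<Rightarrow> bool" where
  "complete_colouring G C f \<longleftrightarrow>
     (\<forall>c1 \<in> C. \<forall>c2 \<in> C. c1 \<noteq> c2 \<longrightarrow>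
        (\<exists>v1 v2. (v1, v2) \<in> parcs G \<and> f v1 = c1 \<and> f v2 = c2))"

text \<open>
  Colours are natural numbers. This is no restriction, since only the cardinality of the finite
  colour set matters. As \<^const>\<open>Max\<close> is unspecified on infinite sets and on the empty set, the
  lemmas \<open>finite_colour_numbers\<close> and \<open>colour_numbers_nonempty\<close> below show that the maximum is
  taken over a finite nonempty set.
\<close>

definition colour_numbers :: "'a pair_pre_digraph \<Rightarrow> nat set" where
  "colour_numbers G =
     {card C | (C :: nat set) f. finite C \<and> f \<in> pverts G \<rightarrow> C
        \<and> proper_colouring G f \<and> complete_colouring G C f}"

definition achr :: "'a pair_pre_digraph \<Rightarrow> nat" where
  "achr G = Max (colour_numbers G)"

lemma pair_graph_complete_graph: "pair_graph (complete_graph n)"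
proof
  show "finite (parcs (complete_graph n))"
    by (rule finite_subset[of _ "{..<n} \<times> {..<n}"]) (auto simp: complete_graph_def)
qed (auto simp: complete_graph_def symmetric_conv intro!: symI)

lemma complete_digraph_complete_graph: "complete_digraph n (with_proj (complete_graph n))"
  unfolding complete_digraph_pair_def
  using pair_graph_complete_graph[of n] by (auto simp: complete_graph_def)

lemma pair_graph_cartesian_product:
  assumes "pair_graph G" "pair_graph H"
  shows "pair_graph (G \<box> H)"
proof -
  interpret G: pair_graph G by fact
  interpret H: pair_graph H by fact
  have sub: "parcs (G \<box> H) \<subseteq> pverts (G \<box> H) \<times> pverts (G \<box> H)"
    unfolding cartesian_product_def by (auto dest: G.in_arcsD1 G.in_arcsD2 H.in_arcsD1 H.in_arcsD2)
  show ?thesis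
  proof
    show "finite (pverts (G \<box> H))" by (simp add: cartesian_product_def)
    then show "finite (parcs (G \<box> H))" using sub by (meson finite_SigmaI finite_subset)
    show "fst e \<in> pverts (G \<box> H)" if "e \<in> parcs (G \<box> H)" for e using sub that by auto
    show "snd e \<in> pverts (G \<box> H)" if "e \<in> parcs (G \<box> H)" for e using sub that by auto
    show "fst e \<noteq> snd e" if "e \<in> parcs (G \<box> H)" for e
      using that G.no_loops' H.no_loops' by (auto simp: cartesian_product_def)
    show "symmetric (with_proj (G \<box> H))"
      by (auto simp: symmetric_def cartesian_product_def intro!: symI G.arcs_symmetric H.arcs_symmetric)
  qed
qed

lemma finite_colour_numbers:
  assumes "pair_graph G"
  shows "finite (colour_numbers G)"
proof -
  interpret G: pair_graph G by fact
  have "card C \<le> Suc (card (pverts G))"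
    if C: "finite C" and c: "complete_colouring G C f" for C :: "nat set" and f
  proof (cases "\<exists>a b. a \<in> C \<and> b \<in> C \<and> a \<noteq> b")
    case True
    have "C \<subseteq> f ` pverts G"
    proof
      fix a assume a: "a \<in> C"
      with True obtain b where "b \<in> C" "a \<noteq> b" by metis
      with a c obtain u v where "(u, v) \<in> parcs G" "f u = a"
        unfolding complete_colouring_def by blast
      then show "a \<in> f ` pverts G" by (auto dest: G.in_arcsD1)
    qed
    then have "card C \<le> card (pverts G)"
      using G.pair_finite_verts by (meson surj_card_le)
    then show ?thesis by simp
  next
    case False
    then have "card C \<le> Suc 0" using C by (auto simp: card_le_Suc0_iff_eq)
    then show ?thesis by simp
  qed
  then have "colour_numbers G \<subseteq> {..Suc (card (pverts G))}"
    unfolding colour_numbers_def by blast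
  then show ?thesis by (rule finite_subset) simp
qed

lemma colour_numbers_nonempty:
  assumes "pair_graph G"
  shows "colour_numbers G \<noteq> {}"
proof -
  interpret G: pair_graph G by fact
  define P where "P k \<longleftrightarrow> (\<exists>(C :: nat set) f. finite C \<and> card C = k \<and> f \<in> pverts G \<rightarrow> C
     \<and> proper_colouring G f)" for k
  obtain f :: "'a \<Rightarrow> nat" where inj: "inj_on f (pverts G)"
    using G.pair_finite_verts finite_imp_inj_to_nat_seg by blast
  have "proper_colouring G f"
    unfolding proper_colouring_def
    using inj G.in_arcsD1 G.in_arcsD2 G.no_loops' by (fastforce dest: inj_onD)
  then have "P (card (f ` pverts G))"
    unfolding P_def using G.pair_finite_verts by blast
  then have "P (LEAST k. P k)" by (rule LeastI)
  then obtain C :: "nat set" and g where C: "finite C" "card C = (LEAST k. P k)"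
    "g \<in> pverts G \<rightarrow> C" "proper_colouring G g"
    unfolding P_def by blast
  have "complete_colouring G C g"
  proof (rule ccontr)
    assume "\<not> complete_colouring G C g"
    then obtain a b where ab: "a \<in> C" "b \<in> C" "a \<noteq> b"
      "\<And>u v. (u, v) \<in> parcs G \<Longrightarrow> g u = a \<Longrightarrow> g v \<noteq> b"
      unfolding complete_colouring_def by blast
    let ?h = "\<lambda>v. if g v = b then a else g v"
    have "?h u \<noteq> ?h v" if uv: "(u, v) \<in> parcs G" for u v
    proof -
      from uv have "(v, u) \<in> parcs G" by (rule G.arcs_symmetric)
      then have "g u \<noteq> g v" "\<not> (g u = a \<and> g v = b)" "\<not> (g v = a \<and> g u = b)"
        using uv C(4) ab(4) unfolding proper_colouring_def by auto
      then show ?thesis by auto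
    qed
    then have "proper_colouring G ?h"
      unfolding proper_colouring_def by blast
    moreover have "?h \<in> pverts G \<rightarrow> C - {b}" using C(3) ab(1,3) by (auto split: if_splits)
    ultimately have "P (card (C - {b}))" unfolding P_def using C(1) by blast
    then have "(LEAST k. P k) \<le> card (C - {b})" by (rule Least_le)
    moreover have "card (C - {b}) < card C" using C(1) ab(2) by (rule card_Diff1_less)
    ultimately show False using C(2) by simp
  qed
  with C show ?thesis unfolding colour_numbers_def by blast
qed

end

theory Submission
  imports Defs
begin

text \<open>
  A colouring of \<open>K\<^sub>6 \<box> K\<^sub>7\<close> fills a 6 by 7 grid; properness says that no colour is repeated in a
  row or a column, completeness that any two colours occur together in some row or column.  An
  explicit filling with 18 colours gives the lower bound.

  For the upper bound suppose that at least 19 colours are used.  A colour with a single cell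
  shares its row or column with only 11 cells, so every colour has at least two cells, and most of
  the 42 cells belong to \<^emph>\<open>doubles\<close>, colours with exactly two.  A double occupies two
  rows and two columns, and two doubles are adjacent iff they share a row or a column.  Moreover a
  double shares a line with only 20 further cells, in which at least 18 colours must appear.

  The heart of the proof is a count.  If \<open>a\<close> and \<open>b\<close> are the numbers of rows and columns shared by
  two doubles, then, as they are adjacent, \<open>(1 - a) (1 - b)\<close> is at most \<open>0\<close>, unless they have the same
  rows and the same columns.  Summing this product over all pairs turns it into a quadratic form in the
  numbers of doubles on the rows, on the columns, and on both (\<open>pair_family_inequality\<close>).  Every row
  meets nearly all colours, so these numbers vary in short intervals, and the form is so large that
  many pairs must be exceptional: there are exactly 19 colours (\<open>card_colours\<close>), and among any 15
  doubles at least six occur in \<^emph>\<open>blocks\<close> (\<open>six_paired\<close>), where a block is a 2 by 2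
  subgrid filled by two doubles that have the same rows and columns.

  So there are three blocks.  Since a double has only 20 cells in sight, any two of them share exactly
  one line (\<open>blocks_share_one_line\<close>).  Up to permutations of rows and columns this leaves six
  arrangements of three blocks.  In each of them the other nine of the 15 doubles must share a line
  with every block and with each other, while every row must meet at least three and every column at least
  two of the 15 doubles.  An exhaustive search, proved correct in \<open>refutes_sound\<close>, shows that this is impossible.
\<close>

section \<open>Pairs of rows and pairs of columns\<close>

lemma of_bool_sum_card:
  assumes "finite A"
  shows "(\<Sum>x\<in>A. of_bool (P x)) = int (card {x \<in> A. P x})"
  using assms by (simp add: Int_def)

text \<open>The summand \<open>(1 - a) (1 - b)\<close>, where \<open>a\<close> and \<open>b\<close> count the common rows and columns of \<open>x\<close> and \<open>y\<close>,
vanishes when one of them is \<open>1\<close>, is negative for \<open>(0, 2)\<close> and \<open>(2, 0)\<close>, and equals \<open>1\<close> for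
\<open>(2, 2)\<close>; the remaining value \<open>(0, 0)\<close> is excluded by \<open>meet\<close>.  As \<open>a\<close>, \<open>b\<close> and \<open>a b\<close> are sums of
products of indicator functions, the double sum becomes a combination of sums of squares.\<close>
lemma pair_family_inequality:
  fixes T :: "'a set" and R K :: "'a \<Rightarrow> nat set"
  defines "n \<equiv> \<lambda>i. int (card {x \<in> T. i \<in> R x})"
    and "m \<equiv> \<lambda>j. int (card {x \<in> T. j \<in> K x})"
    and "d \<equiv> \<lambda>i j. int (card {x \<in> T. i \<in> R x \<and> j \<in> K x})"
  assumes fin: "finite T" "finite I" "finite J"
    and R: "\<And>x. x \<in> T \<Longrightarrow> R x \<subseteq> I \<and> card (R x) = 2"
    and K: "\<And>x. x \<in> T \<Longrightarrow> K x \<subseteq> J \<and> card (K x) = 2"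
    and meet: "\<And>x y. x \<in> T \<Longrightarrow> y \<in> T \<Longrightarrow> R x \<inter> R y \<noteq> {} \<or> K x \<inter> K y \<noteq> {}"
  shows "(int (card T))\<^sup>2 - (\<Sum>i\<in>I. (n i)\<^sup>2) - (\<Sum>j\<in>J. (m j)\<^sup>2) + (\<Sum>i\<in>I. \<Sum>j\<in>J. (d i j)\<^sup>2)
    \<le> int (card {(x, y) \<in> T \<times> T. R x = R y \<and> K x = K y})"
proof -
  define a where "a x y = int (card (R x \<inter> R y))" for x y
  define b where "b x y = int (card (K x \<inter> K y))" for x y
  have a: "a x y = (\<Sum>i\<in>I. of_bool (i \<in> R x) * of_bool (i \<in> R y))" if "x \<in> T" for x y
  proof -
    have "{i \<in> I. i \<in> R x \<and> i \<in> R y} = R x \<inter> R y" using R[OF that] by blast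
    then show ?thesis
      using of_bool_sum_card[OF fin(2), of "\<lambda>i. i \<in> R x \<and> i \<in> R y"] by (simp add: a_def of_bool_conj)
  qed
  have b: "b x y = (\<Sum>j\<in>J. of_bool (j \<in> K x) * of_bool (j \<in> K y))" if "x \<in> T" for x y
  proof -
    have "{j \<in> J. j \<in> K x \<and> j \<in> K y} = K x \<inter> K y" using K[OF that] by blast
    then show ?thesis
      using of_bool_sum_card[OF fin(3), of "\<lambda>j. j \<in> K x \<and> j \<in> K y"] by (simp add: b_def of_bool_conj)
  qed
  have n: "n i = (\<Sum>x\<in>T. of_bool (i \<in> R x))" for i
    unfolding n_def by (rule of_bool_sum_card[OF fin(1), symmetric])
  have m: "m j = (\<Sum>x\<in>T. of_bool (j \<in> K x))" for j
    unfolding m_def by (rule of_bool_sum_card[OF fin(1), symmetric])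
  have d: "d i j = (\<Sum>x\<in>T. of_bool (i \<in> R x) * of_bool (j \<in> K x))" for i j
    unfolding d_def using of_bool_sum_card[OF fin(1), of "\<lambda>x. i \<in> R x \<and> j \<in> K x"]
    by (simp add: of_bool_conj)
  have sum_a: "(\<Sum>x\<in>T. \<Sum>y\<in>T. a x y) = (\<Sum>i\<in>I. (n i)\<^sup>2)"
  proof -
    have "(\<Sum>x\<in>T. \<Sum>y\<in>T. a x y) = (\<Sum>x\<in>T. \<Sum>i\<in>I. \<Sum>y\<in>T. of_bool (i \<in> R x) * of_bool (i \<in> R y))"
      by (intro sum.cong refl) (simp add: a, rule sum.swap)
    also have "\<dots> = (\<Sum>i\<in>I. \<Sum>x\<in>T. \<Sum>y\<in>T. of_bool (i \<in> R x) * of_bool (i \<in> R y))"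
      by (rule sum.swap)
    finally show ?thesis by (simp only: n power2_eq_square sum_product)
  qed
  have sum_b: "(\<Sum>x\<in>T. \<Sum>y\<in>T. b x y) = (\<Sum>j\<in>J. (m j)\<^sup>2)"
  proof -
    have "(\<Sum>x\<in>T. \<Sum>y\<in>T. b x y) = (\<Sum>x\<in>T. \<Sum>j\<in>J. \<Sum>y\<in>T. of_bool (j \<in> K x) * of_bool (j \<in> K y))"
      by (intro sum.cong refl) (simp add: b, rule sum.swap)
    also have "\<dots> = (\<Sum>j\<in>J. \<Sum>x\<in>T. \<Sum>y\<in>T. of_bool (j \<in> K x) * of_bool (j \<in> K y))"
      by (rule sum.swap)
    finally show ?thesis by (simp only: m power2_eq_square sum_product)
  qed
  have sum_ab: "(\<Sum>x\<in>T. \<Sum>y\<in>T. a x y * b x y) = (\<Sum>i\<in>I. \<Sum>j\<in>J. (d i j)\<^sup>2)"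
  proof -
    define e where "e i j x = (of_bool (i \<in> R x) * of_bool (j \<in> K x) :: int)" for i j x
    have "a x y * b x y = (\<Sum>i\<in>I. \<Sum>j\<in>J. e i j x * e i j y)" if "x \<in> T" for x y
      unfolding a[OF that] b[OF that] sum_product e_def by (intro sum.cong refl) (simp add: mult_ac)
    then have "(\<Sum>x\<in>T. \<Sum>y\<in>T. a x y * b x y) = (\<Sum>x\<in>T. \<Sum>y\<in>T. \<Sum>i\<in>I. \<Sum>j\<in>J. e i j x * e i j y)"
      by (intro sum.cong refl) simp
    also have "\<dots> = (\<Sum>i\<in>I. \<Sum>j\<in>J. \<Sum>x\<in>T. \<Sum>y\<in>T. e i j x * e i j y)"
    proof -
      have "(\<Sum>x\<in>T. \<Sum>y\<in>T. \<Sum>i\<in>I. \<Sum>j\<in>J. e i j x * e i j y)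
        = (\<Sum>x\<in>T. \<Sum>i\<in>I. \<Sum>y\<in>T. \<Sum>j\<in>J. e i j x * e i j y)"
        by (intro sum.cong refl) (rule sum.swap)
      also have "\<dots> = (\<Sum>i\<in>I. \<Sum>x\<in>T. \<Sum>y\<in>T. \<Sum>j\<in>J. e i j x * e i j y)" by (rule sum.swap)
      also have "\<dots> = (\<Sum>i\<in>I. \<Sum>x\<in>T. \<Sum>j\<in>J. \<Sum>y\<in>T. e i j x * e i j y)"
        by (intro sum.cong refl) (rule sum.swap)
      also have "\<dots> = (\<Sum>i\<in>I. \<Sum>j\<in>J. \<Sum>x\<in>T. \<Sum>y\<in>T. e i j x * e i j y)"
        by (intro sum.cong refl) (rule sum.swap)
      finally show ?thesis .
    qed
    also have "\<dots> = (\<Sum>i\<in>I. \<Sum>j\<in>J. (d i j)\<^sup>2)"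
      by (simp only: d power2_eq_square sum_product e_def)
    finally show ?thesis .
  qed
  have le: "(1 - a x y) * (1 - b x y) \<le> of_bool (R x = R y \<and> K x = K y)" if xy: "x \<in> T" "y \<in> T" for x y
  proof -
    have finR: "finite (R x)" "finite (R y)" "finite (K x)" "finite (K y)"
      using R K xy fin finite_subset by metis+
    have cards: "card (R x) = 2" "card (R y) = 2" "card (K x) = 2" "card (K y) = 2" using R K xy by auto
    have le2: "card (R x \<inter> R y) \<le> 2" "card (K x \<inter> K y) \<le> 2"
      using card_mono[OF finR(1), of "R x \<inter> R y"] card_mono[OF finR(3), of "K x \<inter> K y"] cards by auto
    have eqR: "R x = R y" if "card (R x \<inter> R y) = 2"
      using card_subset_eq[OF finR(1), of "R x \<inter> R y"] card_subset_eq[OF finR(2), of "R x \<inter> R y"] that cards by auto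
    have eqK: "K x = K y" if "card (K x \<inter> K y) = 2"
      using card_subset_eq[OF finR(3), of "K x \<inter> K y"] card_subset_eq[OF finR(4), of "K x \<inter> K y"] that cards by auto
    have pos: "card (R x \<inter> R y) \<noteq> 0 \<or> card (K x \<inter> K y) \<noteq> 0"
      using meet[OF xy] finR by auto
    have ca: "a x y = 0 \<or> a x y = 1 \<or> a x y = 2" and cb: "b x y = 0 \<or> b x y = 1 \<or> b x y = 2"
      using le2 by (auto simp: a_def b_def)
    have nz: "\<not> (a x y = 0 \<and> b x y = 0)" using pos by (simp add: a_def b_def)
    have "R x = R y \<and> K x = K y" if "a x y = 2" "b x y = 2"
      using that eqR eqK by (simp add: a_def b_def)
    then show ?thesis using ca cb nz by auto
  qed
  have "(int (card T))\<^sup>2 - (\<Sum>i\<in>I. (n i)\<^sup>2) - (\<Sum>j\<in>J. (m j)\<^sup>2) + (\<Sum>i\<in>I. \<Sum>j\<in>J. (d i j)\<^sup>2)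
    = (\<Sum>x\<in>T. \<Sum>y\<in>T. (1 - a x y) * (1 - b x y))"
  proof -
    have "(\<Sum>x\<in>T. \<Sum>y\<in>T. (1 - a x y) * (1 - b x y)) = (\<Sum>x\<in>T. \<Sum>y\<in>T. 1 - a x y - b x y + a x y * b x y)"
      by (simp add: algebra_simps)
    then show ?thesis
      by (simp add: sum.distrib sum_subtractf sum_a sum_b sum_ab power2_eq_square)
  qed
  also have "\<dots> \<le> (\<Sum>x\<in>T. \<Sum>y\<in>T. of_bool (R x = R y \<and> K x = K y))"
    by (intro sum_mono le)
  also have "\<dots> = (\<Sum>p\<in>T \<times> T. of_bool (R (fst p) = R (snd p) \<and> K (fst p) = K (snd p)))"
    by (simp add: sum.cartesian_product case_prod_beta)
  also have "\<dots> = int (card {p \<in> T \<times> T. R (fst p) = R (snd p) \<and> K (fst p) = K (snd p)})"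
    by (rule of_bool_sum_card) (simp add: fin)
  also have "{p \<in> T \<times> T. R (fst p) = R (snd p) \<and> K (fst p) = K (snd p)}
    = {(x, y) \<in> T \<times> T. R x = R y \<and> K x = K y}" by auto
  finally show ?thesis .
qed

text \<open>Elements with the \<open>p\<close> largest values, separated from the others by a threshold \<open>t\<close>.\<close>
lemma largest_elements_subset:
  fixes g :: "'a \<Rightarrow> 'b::linorder"
  assumes "finite I" "0 < p" "p \<le> card I"
  shows "\<exists>U t. U \<subseteq> I \<and> card U = p \<and> (\<forall>i\<in>U. t \<le> g i) \<and> (\<forall>i\<in>I - U. g i \<le> t)"
  using assms(2,3)
proof (induction p)
  case 0
  then show ?case by simp
next
  case (Suc p)
  have U: "\<exists>U. U \<subseteq> I \<and> card U = p \<and> (\<forall>i\<in>U. \<forall>j\<in>I - U. g j \<le> g i)"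
  proof (cases "p = 0")
    case True then show ?thesis by (intro exI[of _ "{}"]) auto
  next
    case False
    then obtain U t where "U \<subseteq> I" "card U = p" "\<forall>i\<in>U. t \<le> g i" "\<forall>i\<in>I - U. g i \<le> t"
      using Suc by fastforce
    then show ?thesis by (intro exI[of _ U]) (meson order_trans)
  qed
  then obtain U where U: "U \<subseteq> I" "card U = p" "\<forall>i\<in>U. \<forall>j\<in>I - U. g j \<le> g i" by blast
  have "finite U" using U(1) assms(1) finite_subset by blast
  have ne: "I - U \<noteq> {}"
    using U(1,2) Suc.prems(2) \<open>finite U\<close> by (metis Diff_eq_empty_iff Suc_n_not_le_n subset_antisym)
  define k where "k = Max (g ` (I - U))"
  have "k \<in> g ` (I - U)" unfolding k_def using ne assms(1) by (intro Max_in) auto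
  then obtain u where u: "u \<in> I - U" "g u = k" by blast
  have ku: "g j \<le> k" if "j \<in> I - U" for j
    unfolding k_def using that assms(1) by (intro Max_ge) auto
  have "card (insert u U) = Suc p" using u(1) U(2) \<open>finite U\<close> by simp
  then show ?case
    using U u ku by (intro exI[of _ "insert u U"] exI[of _ k]) auto
qed

text \<open>The function \<open>k\<^sup>2 - 4 k\<close> on \<open>{t..L + 4}\<close> and the function \<open>k\<^sup>2\<close> on \<open>{L..t}\<close> are convex, hence lie below
their chords.  Both chords have slope \<open>t + L\<close>; this is why the interval has length 4 and the
shift has coefficient 4, and it makes the bound depend on the values only through their sum.\<close>
lemma sum_squares_shifted_le:
  fixes g :: "'a \<Rightarrow> int"
  assumes fin: "finite I" and U: "U \<subseteq> I"
    and hi: "\<And>i. i \<in> U \<Longrightarrow> t \<le> g i \<and> g i \<le> L + 4"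
    and lo: "\<And>i. i \<in> I - U \<Longrightarrow> L \<le> g i \<and> g i \<le> t"
  shows "(\<Sum>i\<in>I. (g i)\<^sup>2) - 4 * (\<Sum>i\<in>U. g i)
    \<le> (t + L) * (\<Sum>i\<in>I. g i) - (L + 4) * t * int (card U) - L * t * int (card (I - U))"
proof -
  have finU: "finite U" using U fin finite_subset by blast
  have split: "(\<Sum>i\<in>I. h i) = (\<Sum>i\<in>U. h i) + (\<Sum>i\<in>I - U. h i)" for h :: "'a \<Rightarrow> int"
    using sum.subset_diff[OF U fin, of h] by simp
  have "(g i)\<^sup>2 - 4 * g i \<le> (t + L) * g i - (L + 4) * t" if "i \<in> U" for i
  proof -
    have "(g i - t) * (L + 4 - g i) \<ge> 0" using hi[OF that] by (intro mult_nonneg_nonneg) auto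
    then show ?thesis by (simp add: algebra_simps power2_eq_square)
  qed
  then have 1: "(\<Sum>i\<in>U. (g i)\<^sup>2 - 4 * g i) \<le> (\<Sum>i\<in>U. (t + L) * g i - (L + 4) * t)" by (rule sum_mono)
  have "(g i)\<^sup>2 \<le> (t + L) * g i - L * t" if "i \<in> I - U" for i
  proof -
    have "(g i - L) * (t - g i) \<ge> 0" using lo[OF that] by (intro mult_nonneg_nonneg) auto
    then show ?thesis by (simp add: algebra_simps power2_eq_square)
  qed
  then have 2: "(\<Sum>i\<in>I - U. (g i)\<^sup>2) \<le> (\<Sum>i\<in>I - U. (t + L) * g i - L * t)" by (rule sum_mono)
  have "(\<Sum>i\<in>U. (g i)\<^sup>2) - 4 * sum g U \<le> (t + L) * sum g U - (L + 4) * t * int (card U)"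
    using 1 by (simp add: sum_subtractf mult.commute[of "int (card _)"] flip: sum_distrib_left)
  moreover have "(\<Sum>i\<in>I - U. (g i)\<^sup>2) \<le> (t + L) * sum g (I - U) - L * t * int (card (I - U))"
    using 2 by (simp add: sum_subtractf mult.commute[of "int (card _)"] flip: sum_distrib_left)
  ultimately show ?thesis
    unfolding split[of "\<lambda>i. (g i)\<^sup>2"] split[of g] by (simp add: distrib_left)
qed

text \<open>No integer lies strictly between the points \<open>t\<close> and \<open>t + 1\<close> at which the secant meets the parabola.\<close>
lemma square_above_secant: "(2 * t + 1) * k - t * (t + 1) \<le> k\<^sup>2" for t k :: int
proof -
  have "0 \<le> (k - t) * (k - t - 1)"
    by (cases "k \<le> t") (auto intro: mult_nonneg_nonneg mult_nonpos_nonpos)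
  then show ?thesis by (simp add: algebra_simps power2_eq_square)
qed

section \<open>Complete colourings of the 6 by 7 grid\<close>

text \<open>A colouring with at least 19 colours; the whole theory of this locale is a proof by contradiction.\<close>
locale grid_colouring =
  fixes f :: "nat \<Rightarrow> nat \<Rightarrow> nat" and C :: "nat set"
  assumes finite_C: "finite C"
    and range: "\<And>i j. i < 6 \<Longrightarrow> j < 7 \<Longrightarrow> f i j \<in> C"
    and row_distinct: "\<And>i j j'. i < 6 \<Longrightarrow> j < 7 \<Longrightarrow> j' < 7 \<Longrightarrow> f i j = f i j' \<Longrightarrow> j = j'"
    and col_distinct: "\<And>i i' j. i < 6 \<Longrightarrow> i' < 6 \<Longrightarrow> j < 7 \<Longrightarrow> f i j = f i' j \<Longrightarrow> i = i'"
    and complete: "\<And>x y. x \<in> C \<Longrightarrow> y \<in> C \<Longrightarrow> x \<noteq> y \<Longrightarrow>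
      (\<exists>i<6. \<exists>j<7. \<exists>j'<7. f i j = x \<and> f i j' = y) \<or> (\<exists>j<7. \<exists>i<6. \<exists>i'<6. f i j = x \<and> f i' j = y)"
    and many: "19 \<le> card C"
begin

definition cells :: "nat \<Rightarrow> (nat \<times> nat) set" where
  "cells x = {(i, j). i < 6 \<and> j < 7 \<and> f i j = x}"

definition rows :: "nat \<Rightarrow> nat set" where "rows x = fst ` cells x"
definition cols :: "nat \<Rightarrow> nat set" where "cols x = snd ` cells x"

lemma in_rows: "i \<in> rows x \<longleftrightarrow> i < 6 \<and> (\<exists>j<7. f i j = x)"
  unfolding rows_def cells_def by (auto simp: image_iff)

lemma in_cols: "j \<in> cols x \<longleftrightarrow> j < 7 \<and> (\<exists>i<6. f i j = x)"
  unfolding cols_def cells_def by (auto simp: image_iff)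

lemma rows_subset: "rows x \<subseteq> {..<6}" and cols_subset: "cols x \<subseteq> {..<7}"
  by (auto simp: in_rows in_cols)

lemma finite_rows [simp]: "finite (rows x)" and finite_cols [simp]: "finite (cols x)"
  by (rule finite_subset[OF rows_subset] finite_subset[OF cols_subset], simp)+

lemma finite_cells [simp]: "finite (cells x)"
  by (rule finite_subset[of _ "{..<6} \<times> {..<7}"]) (auto simp: cells_def)

lemma inj_on_fst_cells: "inj_on fst (cells x)" and inj_on_snd_cells: "inj_on snd (cells x)"
  by (auto simp: inj_on_def cells_def intro: row_distinct col_distinct)

lemma card_rows: "card (rows x) = card (cells x)" and card_cols: "card (cols x) = card (cells x)"
  by (simp_all add: rows_def cols_def card_image inj_on_fst_cells inj_on_snd_cells)

lemma lines_meet: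
  assumes "x \<in> C" "y \<in> C" "x \<noteq> y"
  shows "rows x \<inter> rows y \<noteq> {} \<or> cols x \<inter> cols y \<noteq> {}"
proof -
  consider i j j' where "i < 6" "j < 7" "j' < 7" "f i j = x" "f i j' = y"
    | j i i' where "j < 7" "i < 6" "i' < 6" "f i j = x" "f i' j = y"
    using complete[OF assms] by blast
  then show ?thesis
  proof cases
    case 1
    then have "i \<in> rows x \<inter> rows y" by (auto simp: in_rows)
    then show ?thesis by blast
  next
    case 2
    then have "j \<in> cols x \<inter> cols y" by (auto simp: in_cols)
    then show ?thesis by blast
  qed
qed

lemma cells_of_colour_unique: "p \<in> cells x \<Longrightarrow> p \<in> cells y \<Longrightarrow> x = y"
  by (auto simp: cells_def)

lemma card_row: "i < 6 \<Longrightarrow> card {x \<in> C. i \<in> rows x} = 7"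
proof -
  assume i: "i < 6"
  have "{x \<in> C. i \<in> rows x} = f i ` {..<7}" using range i by (auto simp: in_rows)
  moreover have "inj_on (f i) {..<7}" using row_distinct i by (auto simp: inj_on_def)
  ultimately show ?thesis by (simp add: card_image)
qed

lemma card_col: "j < 7 \<Longrightarrow> card {x \<in> C. j \<in> cols x} = 6"
proof -
  assume j: "j < 7"
  have "{x \<in> C. j \<in> cols x} = (\<lambda>i. f i j) ` {..<6}" using range j by (auto simp: in_cols)
  moreover have "inj_on (\<lambda>i. f i j) {..<6}" using col_distinct j by (auto simp: inj_on_def)
  ultimately show ?thesis by (simp add: card_image)
qed

lemma sum_card_cells_inter:
  assumes "A \<subseteq> {..<6} \<times> {..<7}"
  shows "(\<Sum>x\<in>C. card (cells x \<inter> A)) = card A"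
proof -
  have "A = (\<Union>x\<in>C. cells x \<inter> A)" using assms range by (auto simp: cells_def)
  then have "card A = card (\<Union>x\<in>C. cells x \<inter> A)" by simp
  also have "\<dots> = (\<Sum>x\<in>C. card (cells x \<inter> A))"
    using finite_C by (intro card_UN_disjoint) (auto dest: cells_of_colour_unique)
  finally show ?thesis by simp
qed

definition neighbourhood :: "nat \<Rightarrow> (nat \<times> nat) set" where
  "neighbourhood x = {(i, j). i < 6 \<and> j < 7 \<and> (i \<in> rows x \<or> j \<in> cols x)}"

abbreviation seen :: "nat \<Rightarrow> nat \<Rightarrow> nat" where
  "seen x y \<equiv> card (cells y \<inter> neighbourhood x)"

lemma card_neighbourhood:
  "card (neighbourhood x) = 42 - (6 - card (cells x)) * (7 - card (cells x))"
proof -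
  have "neighbourhood x = {..<6} \<times> {..<7} - ({..<6} - rows x) \<times> ({..<7} - cols x)"
    by (auto simp: neighbourhood_def)
  moreover have "card (({..<6} - rows x) \<times> ({..<7} - cols x)) = (6 - card (cells x)) * (7 - card (cells x))"
    using rows_subset cols_subset by (simp add: card_cartesian_product card_Diff_subset card_rows card_cols)
  moreover have "card ({..<6} \<times> {..<7} - ({..<6} - rows x) \<times> ({..<7} - cols x))
    = card ({..<6::nat} \<times> {..<7::nat}) - card (({..<6} - rows x) \<times> ({..<7} - cols x))"
    by (rule card_Diff_subset) auto
  ultimately have "card (neighbourhood x)
    = card ({..<6::nat} \<times> {..<7::nat}) - (6 - card (cells x)) * (7 - card (cells x))"
    by (simp only:)
  then show ?thesis by simp
qed

lemma seen_pos:
  assumes "x \<in> C" "y \<in> C" "x \<noteq> y"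
  shows "1 \<le> seen x y"
proof -
  have "cells y \<inter> neighbourhood x \<noteq> {}"
    using lines_meet[OF assms] unfolding rows_def[of y] cols_def[of y]
    by (force simp: neighbourhood_def cells_def)
  then show ?thesis by (simp add: Suc_le_eq card_gt_0_iff)
qed

text \<open>The cells outside the neighbourhood of \<open>x\<close> form a subgrid, and the colour classes partition the
neighbourhood.\<close>
lemma sum_seen:
  assumes "x \<in> C"
  shows "(\<Sum>y\<in>C - {x}. seen x y) + card (cells x) + (6 - card (cells x)) * (7 - card (cells x)) = 42"
proof -
  define p where "p = (6 - card (cells x)) * (7 - card (cells x))"
  have "cells x \<inter> neighbourhood x = cells x"
    by (force simp: neighbourhood_def cells_def in_rows)
  then have "seen x x = card (cells x)" by simp
  moreover have "(\<Sum>y\<in>C. seen x y) = card (neighbourhood x)"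
    by (rule sum_card_cells_inter) (auto simp: neighbourhood_def)
  moreover have "(\<Sum>y\<in>C. seen x y) = seen x x + (\<Sum>y\<in>C - {x}. seen x y)"
    using assms finite_C by (simp add: sum.remove)
  moreover have "(6 - card (cells x)) * (7 - card (cells x)) \<le> 6 * 7" by (intro mult_mono) auto
  ultimately show ?thesis using card_neighbourhood[of x] unfolding p_def[symmetric] by linarith
qed

lemma card_cells_ge_2:
  assumes "x \<in> C"
  shows "2 \<le> card (cells x)"
proof (rule ccontr)
  assume "\<not> 2 \<le> card (cells x)"
  then consider "card (cells x) = 0" | "card (cells x) = 1" by linarith
  then have "(\<Sum>y\<in>C - {x}. seen x y) \<le> 11" using sum_seen[OF assms] by cases auto
  moreover have "(\<Sum>y\<in>C - {x}. 1) \<le> (\<Sum>y\<in>C - {x}. seen x y)"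
    using seen_pos assms by (intro sum_mono) auto
  moreover have "card (C - {x}) \<ge> 18" using many assms finite_C by simp
  ultimately show False by simp
qed

text \<open>A double has 20 cells of other colours in its neighbourhood, and there are at least 18 other colours,
each of which is seen; hence at most two cells are left over for repetitions.\<close>
lemma sum_seen_le:
  assumes x: "x \<in> C" "card (cells x) = 2" and D: "D \<subseteq> C - {x}"
  shows "(\<Sum>y\<in>D. seen x y) \<le> card D + 2"
proof -
  let ?E = "C - {x} - D"
  have fin: "finite (C - {x})" using finite_C by simp
  have "(\<Sum>y\<in>C - {x}. seen x y) = (\<Sum>y\<in>?E. seen x y) + (\<Sum>y\<in>D. seen x y)"
    using sum.subset_diff[OF D fin] .
  moreover have "(\<Sum>y\<in>C - {x}. seen x y) = 20" using sum_seen[OF x(1)] x(2) by simp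
  moreover have "(\<Sum>y\<in>?E. 1) \<le> (\<Sum>y\<in>?E. seen x y)"
    using seen_pos x D by (intro sum_mono) auto
  moreover have "card ?E + card D = card (C - {x})"
    using D fin by (simp add: card_Diff_subset card_mono finite_subset)
  moreover have "card (C - {x}) \<ge> 18" using many x finite_C by simp
  ultimately show ?thesis by simp
qed

definition doubles :: "nat set" where "doubles = {x \<in> C. card (cells x) = 2}"

lemma finite_doubles: "finite doubles" and doubles_subset: "doubles \<subseteq> C"
  using finite_C by (auto simp: doubles_def)

text \<open>All 42 cells are coloured, and a colour that is not a double has at least three cells.\<close>
lemma sum_card_cells: "2 * card doubles + 3 * card (C - doubles) \<le> 42"
proof -
  have "(\<Sum>x\<in>C. card (cells x)) = 42"
  proof -
    have "cells x \<inter> {..<6} \<times> {..<7} = cells x" for x by (auto simp: cells_def)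
    then show ?thesis using sum_card_cells_inter[of "{..<6} \<times> {..<7}"] by (simp add: card_cartesian_product)
  qed
  moreover have "(\<Sum>x\<in>C. card (cells x)) = (\<Sum>x\<in>C - doubles. card (cells x)) + (\<Sum>x\<in>doubles. card (cells x))"
    using doubles_subset finite_C by (rule sum.subset_diff)
  moreover have "(\<Sum>x\<in>doubles. card (cells x)) = 2 * card doubles" by (simp add: doubles_def)
  moreover have "(\<Sum>x\<in>C - doubles. 3) \<le> (\<Sum>x\<in>C - doubles. card (cells x))"
    using card_cells_ge_2 by (intro sum_mono) (force simp: doubles_def)
  ultimately show ?thesis by simp
qed

text \<open>A row contains seven colours, at most \<open>w\<close> of which lie outside \<open>T\<close>.\<close>
lemma row_count_bounds:
  assumes T: "T \<subseteq> C" "card (C - T) = w" "i < 6"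
  shows "7 \<le> card {x \<in> T. i \<in> rows x} + w" "card {x \<in> T. i \<in> rows x} \<le> 7"
proof -
  have "{x \<in> C. i \<in> rows x} \<subseteq> {x \<in> T. i \<in> rows x} \<union> (C - T)" by blast
  then have "card {x \<in> C. i \<in> rows x} \<le> card ({x \<in> T. i \<in> rows x} \<union> (C - T))"
    using T finite_C by (intro card_mono) (auto intro: finite_subset)
  also have "\<dots> \<le> card {x \<in> T. i \<in> rows x} + card (C - T)" by (rule card_Un_le)
  finally show "7 \<le> card {x \<in> T. i \<in> rows x} + w" using card_row[OF T(3)] T(2) by simp
  have "card {x \<in> T. i \<in> rows x} \<le> card {x \<in> C. i \<in> rows x}"
    using T finite_C by (intro card_mono) auto
  then show "card {x \<in> T. i \<in> rows x} \<le> 7" using card_row[OF T(3)] by simp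
qed

lemma col_count_bounds:
  assumes T: "T \<subseteq> C" "card (C - T) = w" "j < 7"
  shows "6 \<le> card {x \<in> T. j \<in> cols x} + w" "card {x \<in> T. j \<in> cols x} \<le> 6"
proof -
  have "{x \<in> C. j \<in> cols x} \<subseteq> {x \<in> T. j \<in> cols x} \<union> (C - T)" by blast
  then have "card {x \<in> C. j \<in> cols x} \<le> card ({x \<in> T. j \<in> cols x} \<union> (C - T))"
    using T finite_C by (intro card_mono) (auto intro: finite_subset)
  also have "\<dots> \<le> card {x \<in> T. j \<in> cols x} + card (C - T)" by (rule card_Un_le)
  finally show "6 \<le> card {x \<in> T. j \<in> cols x} + w" using card_col[OF T(3)] T(2) by simp
  have "card {x \<in> T. j \<in> cols x} \<le> card {x \<in> C. j \<in> cols x}"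
    using T finite_C by (intro card_mono) auto
  then show "card {x \<in> T. j \<in> cols x} \<le> 6" using card_col[OF T(3)] by simp
qed

section \<open>Twin colours\<close>

definition twins :: "nat \<Rightarrow> nat \<Rightarrow> bool" where
  "twins x y \<longleftrightarrow> x \<noteq> y \<and> rows x = rows y \<and> cols x = cols y"

definition paired :: "nat set \<Rightarrow> nat set" where
  "paired T = {x \<in> T. \<exists>y\<in>T. twins x y}"

text \<open>Two colours that occupy the same two rows and columns fill one 2 by 2 subgrid, and each of them
has one of the two cells of that subgrid in a given row.\<close>
lemma block_colours:
  assumes "x \<in> doubles"
  obtains u v where "{y. y \<in> doubles \<and> rows y = rows x \<and> cols y = cols x} \<subseteq> {u, v}"
proof -
  have "card (rows x) = 2" "card (cols x) = 2"
    using assms by (auto simp: doubles_def card_rows card_cols)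
  then obtain i j j' where i: "i \<in> rows x" and c: "cols x = {j, j'}"
    by (metis card_2_iff insertI1)
  have "y \<in> {f i j, f i j'}" if "rows y = rows x" "cols y = cols x" for y
  proof -
    from i that(1) have "i \<in> rows y" by simp
    then obtain k where "k < 7" "f i k = y" "i < 6" by (auto simp: in_rows)
    then have "k \<in> cols y" by (auto simp: in_cols)
    then show ?thesis using that c \<open>f i k = y\<close> by auto
  qed
  then show ?thesis using that by blast
qed

lemma double_sizes: "x \<in> doubles \<Longrightarrow> card (rows x) = 2 \<and> card (cols x) = 2 \<and> card (cells x) = 2"
  by (simp add: doubles_def card_rows card_cols)

text \<open>In the row \<open>i\<close> both colours have a cell, and these cells lie in different columns, hence in both
columns of the block.\<close>
lemma block_cells:
  assumes z: "z \<in> doubles" "twins z z'" "i \<in> rows z" "j \<in> cols z"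
  shows "f i j = z \<or> f i j = z'"
proof -
  have ij: "i < 6" "j < 7" using z by (auto simp: in_rows in_cols)
  from z have "i \<in> rows z'" by (simp add: twins_def)
  then obtain k k' where k: "k < 7" "f i k = z" and k': "k' < 7" "f i k' = z'"
    using z(3) by (auto simp: in_rows)
  have "k \<noteq> k'" using k k' z(2) by (auto simp: twins_def)
  moreover have "k \<in> cols z" "k' \<in> cols z'" using k k' ij by (auto simp: in_cols)
  moreover have "cols z' = cols z" using z(2) by (simp add: twins_def)
  ultimately have "cols z = {k, k'}"
    using double_sizes[OF z(1)] by (metis card_2_iff doubleton_eq_iff insertE singletonD)
  then show ?thesis using z(4) k k' by auto
qed

text \<open>The pairs with equal rows and columns are the diagonal pairs and the pairs of twins, and a colour has
at most one twin.\<close>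
lemma card_same_lines:
  assumes T: "T \<subseteq> doubles"
  shows "card {(x, y) \<in> T \<times> T. rows x = rows y \<and> cols x = cols y} \<le> card T + card (paired T)"
proof -
  have finT: "finite T" using T finite_doubles finite_subset by blast
  define P where "P = {(x, y) \<in> T \<times> T. twins x y}"
  have "{(x, y) \<in> T \<times> T. rows x = rows y \<and> cols x = cols y} \<subseteq> (\<lambda>x. (x, x)) ` T \<union> P"
    by (auto simp: P_def twins_def)
  moreover have "finite P" unfolding P_def using finT by (auto intro: finite_subset[of _ "T \<times> T"])
  ultimately have "card {(x, y) \<in> T \<times> T. rows x = rows y \<and> cols x = cols y} \<le> card ((\<lambda>x. (x, x)) ` T \<union> P)"
    using finT by (intro card_mono) auto
  also have "\<dots> \<le> card ((\<lambda>x. (x, x)) ` T) + card P" by (rule card_Un_le)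
  also have "\<dots> \<le> card T + card P" using card_image_le[OF finT] by simp
  also have "card P \<le> card (paired T)"
  proof (rule card_inj_on_le)
    show "fst ` P \<subseteq> paired T" by (auto simp: P_def paired_def)
    show "finite (paired T)" using finT by (simp add: paired_def)
    show "inj_on fst P"
    proof (rule inj_onI)
      fix p q assume p: "p \<in> P" and q: "q \<in> P" and eq: "fst p = fst q"
      obtain x y z where xyz: "p = (x, y)" "q = (x, z)" using eq by (cases p; cases q) auto
      from p q xyz T have x: "x \<in> doubles" and yz: "y \<in> doubles" "z \<in> doubles" "twins x y" "twins x z"
        by (auto simp: P_def)
      obtain u v where "{y. y \<in> doubles \<and> rows y = rows x \<and> cols y = cols x} \<subseteq> {u, v}"
        using block_colours[OF x] .
      then have "x \<in> {u, v}" "y \<in> {u, v}" "z \<in> {u, v}" using x yz by (auto simp: twins_def)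
      then show "p = q" using yz xyz by (auto simp: twins_def)
    qed
  qed
  finally show ?thesis by simp
qed

text \<open>Besides \<open>pair_family_inequality\<close> for doubles, the identities that count each double once for each of
its two rows and once for each of its two columns.\<close>
lemma doubles_inequality:
  fixes T :: "nat set"
  defines "n \<equiv> \<lambda>i. int (card {x \<in> T. i \<in> rows x})"
    and "m \<equiv> \<lambda>j. int (card {x \<in> T. j \<in> cols x})"
    and "d \<equiv> \<lambda>i j. int (card {x \<in> T. i \<in> rows x \<and> j \<in> cols x})"
  assumes T: "T \<subseteq> doubles"
  shows "(int (card T))\<^sup>2 - (\<Sum>i<6. (n i)\<^sup>2) - (\<Sum>j<7. (m j)\<^sup>2) + (\<Sum>i<6. \<Sum>j<7. (d i j)\<^sup>2)
      \<le> int (card T) + int (card (paired T))"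
    and "(\<Sum>i<6. n i) = 2 * int (card T)" "(\<Sum>j<7. m j) = 2 * int (card T)"
    and "\<And>i. (\<Sum>j<7. d i j) = 2 * n i" "\<And>j. (\<Sum>i<6. d i j) = 2 * m j"
proof -
  have finT: "finite T" using T finite_doubles finite_subset by blast
  have meet: "rows x \<inter> rows y \<noteq> {} \<or> cols x \<inter> cols y \<noteq> {}" if "x \<in> T" "y \<in> T" for x y
  proof (cases "x = y")
    case True
    then show ?thesis using double_sizes[of x] that T by auto
  next
    case False
    then show ?thesis using lines_meet that T doubles_subset by blast
  qed
  have "(int (card T))\<^sup>2 - (\<Sum>i<6. (n i)\<^sup>2) - (\<Sum>j<7. (m j)\<^sup>2) + (\<Sum>i<6. \<Sum>j<7. (d i j)\<^sup>2)
      \<le> int (card {(x, y) \<in> T \<times> T. rows x = rows y \<and> cols x = cols y})"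
    unfolding n_def m_def d_def
    using finT rows_subset cols_subset double_sizes T meet by (intro pair_family_inequality) auto
  then show "(int (card T))\<^sup>2 - (\<Sum>i<6. (n i)\<^sup>2) - (\<Sum>j<7. (m j)\<^sup>2) + (\<Sum>i<6. \<Sum>j<7. (d i j)\<^sup>2)
      \<le> int (card T) + int (card (paired T))"
    using card_same_lines[OF T] by linarith
  have swap: "(\<Sum>k\<in>A. int (card {x \<in> T. P x \<and> k \<in> L x})) = (\<Sum>x\<in>{x \<in> T. P x}. int (card (L x \<inter> A)))"
    if "finite A" for A :: "nat set" and L P
  proof -
    have "(\<Sum>k\<in>A. int (card {x \<in> T. P x \<and> k \<in> L x})) = (\<Sum>k\<in>A. \<Sum>x\<in>{x \<in> T. P x}. of_bool (k \<in> L x))"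
    proof (rule sum.cong[OF refl])
      fix k
      have "{x \<in> {x \<in> T. P x}. k \<in> L x} = {x \<in> T. P x \<and> k \<in> L x}" by blast
      then show "int (card {x \<in> T. P x \<and> k \<in> L x}) = (\<Sum>x\<in>{x \<in> T. P x}. of_bool (k \<in> L x))"
        using of_bool_sum_card[of "{x \<in> T. P x}" "\<lambda>x. k \<in> L x"] finT by simp
    qed
    also have "\<dots> = (\<Sum>x\<in>{x \<in> T. P x}. \<Sum>k\<in>A. of_bool (k \<in> L x))" by (rule sum.swap)
    also have "\<dots> = (\<Sum>x\<in>{x \<in> T. P x}. int (card (L x \<inter> A)))"
    proof (rule sum.cong[OF refl])
      fix x
      have "{k \<in> A. k \<in> L x} = L x \<inter> A" by blast
      then show "(\<Sum>k\<in>A. of_bool (k \<in> L x)) = int (card (L x \<inter> A))"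
        using of_bool_sum_card[OF that, of "\<lambda>k. k \<in> L x"] by simp
    qed
    finally show ?thesis .
  qed
  have r: "rows x \<inter> {..<6} = rows x" and c: "cols x \<inter> {..<7} = cols x" for x
    using rows_subset cols_subset by blast+
  have two: "(\<Sum>x\<in>{x \<in> T. P x}. int (card (rows x))) = 2 * int (card {x \<in> T. P x})"
    "(\<Sum>x\<in>{x \<in> T. P x}. int (card (cols x))) = 2 * int (card {x \<in> T. P x})" for P
    using T double_sizes by (simp_all add: subset_iff)
  show "(\<Sum>i<6. n i) = 2 * int (card T)"
    using swap[of "{..<6}" "\<lambda>_. True" rows] two(1)[of "\<lambda>_. True"] by (simp add: n_def r)
  show "(\<Sum>j<7. m j) = 2 * int (card T)"
    using swap[of "{..<7}" "\<lambda>_. True" cols] two(2)[of "\<lambda>_. True"] by (simp add: m_def c)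
  show "(\<Sum>j<7. d i j) = 2 * n i" for i
    using swap[of "{..<7}" "\<lambda>x. i \<in> rows x" cols] two(2)[of "\<lambda>x. i \<in> rows x"] by (simp add: d_def n_def c)
  show "(\<Sum>i<6. d i j) = 2 * m j" for j
    using swap[of "{..<6}" "\<lambda>x. j \<in> cols x" rows] two(1)[of "\<lambda>x. j \<in> cols x"]
    by (simp add: d_def m_def r conj_commute)
qed

end

section \<open>At least three blocks\<close>

context grid_colouring
begin

text \<open>With \<open>w \<le> 2\<close> other colours, a row meets between \<open>7 - w\<close> and \<open>7\<close> doubles and a column between
\<open>6 - w\<close> and \<open>6\<close>.  Bounding squares above by the chords over these intervals and \<open>d\<^sup>2\<close> below by the
secant through \<open>1\<close> and \<open>2\<close> leaves a quadratic inequality for the number \<open>c\<close> of doubles without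
solutions.\<close>
lemma three_non_doubles: "3 \<le> card (C - doubles)"
proof (rule ccontr)
  assume "\<not> 3 \<le> card (C - doubles)"
  define w c where "w = int (card (C - doubles))" and "c = int (card doubles)"
  have w: "w = 0 \<or> w = 1 \<or> w = 2" using \<open>\<not> 3 \<le> card (C - doubles)\<close> by (auto simp: w_def)
  define n where "n i = int (card {x \<in> doubles. i \<in> rows x})" for i
  define m where "m j = int (card {x \<in> doubles. j \<in> cols x})" for j
  define d where "d i j = int (card {x \<in> doubles. i \<in> rows x \<and> j \<in> cols x})" for i j
  note ineq = doubles_inequality[OF subset_refl, folded n_def m_def d_def c_def]
  have n: "(n i)\<^sup>2 \<le> (14 - w) * n i - 7 * (7 - w)" if "i < 6" for i
  proof -
    have "7 - w \<le> n i" "n i \<le> 7"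
      using row_count_bounds[OF doubles_subset refl that] by (simp_all add: n_def w_def)
    then have "0 \<le> (7 - n i) * (n i - (7 - w))" by simp
    then show ?thesis by (simp add: algebra_simps power2_eq_square)
  qed
  have m: "(m j)\<^sup>2 \<le> (12 - w) * m j - 6 * (6 - w)" if "j < 7" for j
  proof -
    have "6 - w \<le> m j" "m j \<le> 6"
      using col_count_bounds[OF doubles_subset refl that] by (simp_all add: m_def w_def)
    then have "0 \<le> (6 - m j) * (m j - (6 - w))" by simp
    then show ?thesis by (simp add: algebra_simps power2_eq_square)
  qed
  have "(\<Sum>i<6. (n i)\<^sup>2) \<le> (\<Sum>i<6. (14 - w) * n i - 7 * (7 - w))" using n by (intro sum_mono) simp
  also have "\<dots> = (14 - w) * (2 * c) - 42 * (7 - w)"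
    using ineq(2) by (simp add: sum_subtractf flip: sum_distrib_left)
  finally have 1: "(\<Sum>i<6. (n i)\<^sup>2) \<le> (14 - w) * (2 * c) - 42 * (7 - w)" .
  have "(\<Sum>j<7. (m j)\<^sup>2) \<le> (\<Sum>j<7. (12 - w) * m j - 6 * (6 - w))" using m by (intro sum_mono) simp
  also have "\<dots> = (12 - w) * (2 * c) - 42 * (6 - w)"
    using ineq(3) by (simp add: sum_subtractf flip: sum_distrib_left)
  finally have 2: "(\<Sum>j<7. (m j)\<^sup>2) \<le> (12 - w) * (2 * c) - 42 * (6 - w)" .
  have "(\<Sum>i<6. \<Sum>j<7. 3 * d i j - 2) \<le> (\<Sum>i<6. \<Sum>j<7. (d i j)\<^sup>2)"
    using square_above_secant[of 1] by (intro sum_mono) simp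
  moreover have "(\<Sum>i<6. \<Sum>j<7. 3 * d i j - 2) = 12 * c - 84"
  proof -
    have "(\<Sum>i<6. \<Sum>j<7. 3 * d i j - 2) = (\<Sum>i<6. 6 * n i - 14)"
      using ineq(4) by (intro sum.cong refl) (simp add: sum_subtractf flip: sum_distrib_left)
    also have "\<dots> = 12 * c - 84" using ineq(2) by (simp add: sum_subtractf flip: sum_distrib_left)
    finally show ?thesis .
  qed
  moreover have "int (card (paired doubles)) \<le> c"
    unfolding c_def using finite_doubles by (simp add: paired_def card_mono)
  ultimately have "c\<^sup>2 - ((14 - w) * (2 * c) - 42 * (7 - w)) - ((12 - w) * (2 * c) - 42 * (6 - w)) + (12 * c - 84) \<le> c + c"
    using 1 2 ineq(1) by linarith
  then have "(c - (21 - 2 * w))\<^sup>2 + (21 - 4 * w\<^sup>2) \<le> 0"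
    by (simp add: power2_eq_square algebra_simps)
  moreover have "0 < 21 - 4 * w\<^sup>2" using w by auto
  ultimately show False using zero_le_power2[of "c - (21 - 2 * w)"] by linarith
qed

text \<open>With \<open>c\<close> doubles and \<open>w \<ge> 3\<close> other colours, \<open>2 c + 3 w \<le> 42\<close> and \<open>c + w \<ge> 19\<close> force \<open>w \<le> 4\<close> and
\<open>c + w = 19\<close>.\<close>
lemma card_colours: "card C = 19" and many_doubles: "15 \<le> card doubles"
proof -
  have "card C = card doubles + card (C - doubles)"
    using doubles_subset finite_C finite_doubles by (simp add: card_Diff_subset card_mono)
  then show "card C = 19" "15 \<le> card doubles" using three_non_doubles sum_card_cells many by linarith+
qed

text \<open>The form in \<open>doubles_inequality\<close> is small only if the counts on the rows and columns are uneven, but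
then the counts \<open>d i j\<close> are uneven as well, and their squares make up for it.  To see this,
\<open>(d i j)\<^sup>2\<close> is bounded below by the secant through \<open>t\<close> and \<open>t + 1\<close>, where \<open>t\<close> is \<open>0\<close>, \<open>1\<close> or \<open>2\<close> according
to how many of the row \<open>i\<close> and the column \<open>j\<close> are among the three fullest rows \<open>U\<close> and the four fullest
columns \<open>W\<close>.  The linear terms shift the squares of the counts by four times the counts on \<open>U\<close> and
\<open>W\<close>, which is the situation of \<open>sum_squares_shifted_le\<close>.\<close>
lemma six_paired:
  assumes T: "T \<subseteq> doubles" "card T = 15"
  shows "6 \<le> card (paired T)"
proof -
  have TC: "T \<subseteq> C" using T doubles_subset by blast
  have w: "card (C - T) = 4"
    using T TC card_colours finite_C by (simp add: card_Diff_subset finite_subset)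
  define n where "n i = int (card {x \<in> T. i \<in> rows x})" for i
  define m where "m j = int (card {x \<in> T. j \<in> cols x})" for j
  define d where "d i j = int (card {x \<in> T. i \<in> rows x \<and> j \<in> cols x})" for i j
  note ineq = doubles_inequality[OF T(1), folded n_def m_def d_def, unfolded T(2)]
  have n: "3 \<le> n i" "n i \<le> 7" if "i < 6" for i
    using row_count_bounds[OF TC w that] by (simp_all add: n_def)
  have m: "2 \<le> m j" "m j \<le> 6" if "j < 7" for j
    using col_count_bounds[OF TC w that] by (simp_all add: m_def)
  obtain U t where U: "U \<subseteq> {..<6}" "card U = 3" "\<forall>i\<in>U. t \<le> n i" "\<forall>i\<in>{..<6} - U. n i \<le> t"
    using largest_elements_subset[of "{..<6}" 3 n] by auto
  have cU: "card ({..<6} - U) = 3" using U finite_subset[OF U(1)] by (simp add: card_Diff_subset)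
  have "(\<Sum>i<6. (n i)\<^sup>2) - 4 * (\<Sum>i\<in>U. n i)
    \<le> (t + 3) * (\<Sum>i<6. n i) - (3 + 4) * t * int (card U) - 3 * t * int (card ({..<6} - U))"
    using U n by (intro sum_squares_shifted_le) auto
  then have 1: "(\<Sum>i<6. (n i)\<^sup>2) - 4 * (\<Sum>i\<in>U. n i) \<le> 90" using ineq(2) U(2) cU by simp
  obtain W s where W: "W \<subseteq> {..<7}" "card W = 4" "\<forall>j\<in>W. s \<le> m j" "\<forall>j\<in>{..<7} - W. m j \<le> s"
    using largest_elements_subset[of "{..<7}" 4 m] by auto
  have cW: "card ({..<7} - W) = 3" using W finite_subset[OF W(1)] by (simp add: card_Diff_subset)
  have "(\<Sum>j<7. (m j)\<^sup>2) - 4 * (\<Sum>j\<in>W. m j)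
    \<le> (s + 2) * (\<Sum>j<7. m j) - (2 + 4) * s * int (card W) - 2 * s * int (card ({..<7} - W))"
    using W m by (intro sum_squares_shifted_le) auto
  then have 2: "(\<Sum>j<7. (m j)\<^sup>2) - 4 * (\<Sum>j\<in>W. m j) \<le> 60" using ineq(3) W(2) cW by simp
  define u v :: "nat \<Rightarrow> int" where "u i = of_bool (i \<in> U)" and "v j = of_bool (j \<in> W)" for i j
  have su: "(\<Sum>i<6. u i * h i) = (\<Sum>i\<in>U. h i)" for h
  proof -
    have "(\<Sum>i<6. u i * h i) = (\<Sum>i\<in>U. u i * h i)"
      using U(1) by (intro sum.mono_neutral_right) (auto simp: u_def)
    then show ?thesis by (simp add: u_def)
  qed
  have sv: "(\<Sum>j<7. v j * h j) = (\<Sum>j\<in>W. h j)" for h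
  proof -
    have "(\<Sum>j<7. v j * h j) = (\<Sum>j\<in>W. v j * h j)"
      using W(1) by (intro sum.mono_neutral_right) (auto simp: v_def)
    then show ?thesis by (simp add: v_def)
  qed
  have "(2 * (u i + v j) + 1) * d i j - (u i + v j) * (u i + v j + 1) \<le> (d i j)\<^sup>2" for i j
    by (rule square_above_secant)
  moreover have "(2 * (u i + v j) + 1) * d i j - (u i + v j) * (u i + v j + 1)
    = d i j + 2 * (u i * d i j) + 2 * (v j * d i j) - 2 * u i - 2 * v j - 2 * (u i * v j)" for i j
    by (simp add: u_def v_def of_bool_def algebra_simps)
  ultimately have "(\<Sum>i<6. \<Sum>j<7. d i j + 2 * (u i * d i j) + 2 * (v j * d i j) - 2 * u i - 2 * v j - 2 * (u i * v j))
    \<le> (\<Sum>i<6. \<Sum>j<7. (d i j)\<^sup>2)"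
    by (intro sum_mono) metis
  \<comment> \<open>\<open>114\<close> is the sum of \<open>t (t + 1)\<close>: \<open>t = 2\<close> on the 12 cells of \<open>U \<times> W\<close>, and \<open>t = 1\<close> on the 21
    cells with only one of \<open>i \<in> U\<close> and \<open>j \<in> W\<close>.\<close>
  moreover have "(\<Sum>i<6. \<Sum>j<7. d i j + 2 * (u i * d i j) + 2 * (v j * d i j) - 2 * u i - 2 * v j - 2 * (u i * v j))
    = 60 + 4 * (\<Sum>i\<in>U. n i) + 4 * (\<Sum>j\<in>W. m j) - 114"
  proof -
    have a: "(\<Sum>i<6. \<Sum>j<7. d i j) = 60" using ineq(2,4) by (simp flip: sum_distrib_left)
    have b: "(\<Sum>i<6. \<Sum>j<7. u i * d i j) = 2 * (\<Sum>i\<in>U. n i)"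
      using ineq(4) su[of "\<lambda>i. 2 * n i"] by (simp flip: sum_distrib_left)
    have c: "(\<Sum>i<6. \<Sum>j<7. v j * d i j) = 2 * (\<Sum>j\<in>W. m j)"
    proof -
      have "(\<Sum>i<6. \<Sum>j<7. v j * d i j) = (\<Sum>j<7. \<Sum>i<6. v j * d i j)" by (rule sum.swap)
      then show ?thesis using ineq(5) sv[of "\<lambda>j. 2 * m j"] by (simp flip: sum_distrib_left)
    qed
    have u3: "(\<Sum>i<6. u i) = 3" using su[of "\<lambda>_. 1"] U(2) by simp
    have v4: "(\<Sum>j<7. v j) = 4" using sv[of "\<lambda>_. 1"] W(2) by simp
    have e: "(\<Sum>i<6. \<Sum>j<7. u i * v j) = 12"
      using u3 v4 by (simp flip: sum_distrib_left sum_distrib_right)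
    have f: "(\<Sum>i<6. \<Sum>j<7::nat. u i) = 21" "(\<Sum>i<6::nat. \<Sum>j<7. v j) = 24"
      using u3 v4 by (simp_all flip: sum_distrib_left)
    show ?thesis using a b c e f
      by (simp only: sum.distrib sum_subtractf sum_distrib_left[symmetric])
  qed
  ultimately show ?thesis using 1 2 ineq(1) by simp
qed

text \<open>If a second block had both its rows (or both its columns) in common with the block of \<open>x\<close>, then \<open>x\<close>
would see both cells of three colours, its twin and the two colours of the second block, which is
one repetition too many.  If the blocks shared a row and a column, they would share a cell.\<close>
lemma blocks_share_one_line:
  assumes x: "x \<in> doubles" "x' \<in> doubles" "twins x x'"
    and y: "y \<in> doubles" "y' \<in> doubles" "twins y y'"
    and ne: "\<not> (rows x = rows y \<and> cols x = cols y)"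
  shows "card (rows x \<inter> rows y) + card (cols x \<inter> cols y) = 1"
proof -
  have C: "x \<in> C" "x' \<in> C" "y \<in> C" "y' \<in> C" using x y doubles_subset by auto
  have dist: "x \<noteq> y" "x \<noteq> y'" "x' \<noteq> y" "x' \<noteq> y'" "x \<noteq> x'" "y \<noteq> y'"
    using ne x y by (auto simp: twins_def)
  have same: "rows x' = rows x" "cols x' = cols x" "rows y' = rows y" "cols y' = cols y"
    using x y by (auto simp: twins_def)
  have all: "seen x z = 2" if "z \<in> doubles" "rows z \<subseteq> rows x \<or> cols z \<subseteq> cols x" for z
  proof -
    have "cells z \<subseteq> neighbourhood x"
      using that(2) by (force simp: neighbourhood_def rows_def cols_def cells_def)
    then show ?thesis using that(1) double_sizes by (simp add: Int_absorb2)
  qed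
  have "\<not> (rows y \<subseteq> rows x \<or> cols y \<subseteq> cols x)"
  proof
    assume "rows y \<subseteq> rows x \<or> cols y \<subseteq> cols x"
    then have "seen x y = 2" "seen x y' = 2" "seen x x' = 2" using all x y same by auto
    then have "(\<Sum>z\<in>{y, y', x'}. seen x z) = 6" using dist by simp
    moreover have "(\<Sum>z\<in>{y, y', x'}. seen x z) \<le> card {y, y', x'} + 2"
      using sum_seen_le[of x "{y, y', x'}"] C dist x double_sizes by auto
    ultimately show False using dist by simp
  qed
  then have "rows x \<inter> rows y \<subset> rows y" "cols x \<inter> cols y \<subset> cols y" by auto
  then have "card (rows x \<inter> rows y) < 2" "card (cols x \<inter> cols y) < 2"
    using psubset_card_mono[OF finite_rows] psubset_card_mono[OF finite_cols] double_sizes y by metis+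
  moreover have "rows x \<inter> rows y \<noteq> {} \<or> cols x \<inter> cols y \<noteq> {}" using lines_meet C dist by blast
  moreover have "rows x \<inter> rows y = {} \<or> cols x \<inter> cols y = {}"
  proof (rule ccontr)
    assume "\<not> ?thesis"
    then obtain i j where i: "i \<in> rows x" "i \<in> rows y" and j: "j \<in> cols x" "j \<in> cols y" by blast
    show False using block_cells[OF x(1,3) i(1) j(1)] block_cells[OF y(1,3) i(2) j(2)] dist by auto
  qed
  ultimately show ?thesis by (auto simp: Suc_le_eq less_2_cases_iff)
qed

text \<open>A block contains at most two of the at least six paired colours.\<close>
lemma three_blocks:
  assumes T: "T \<subseteq> doubles" "card T = 15"
  obtains x y z where "x \<in> paired T" "y \<in> paired T" "z \<in> paired T"
    "\<not> (rows x = rows y \<and> cols x = cols y)" "\<not> (rows x = rows z \<and> cols x = cols z)"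
    "\<not> (rows y = rows z \<and> cols y = cols z)"
proof -
  have P: "paired T \<subseteq> doubles" using T by (auto simp: paired_def)
  have pick: "\<exists>y\<in>paired T. \<forall>x\<in>S. \<not> (rows y = rows x \<and> cols y = cols x)"
    if S: "S \<subseteq> paired T" "finite S" "card S \<le> 2" for S
  proof (rule ccontr)
    assume *: "\<not> ?thesis"
    define B where "B x = {y. y \<in> doubles \<and> rows y = rows x \<and> cols y = cols x}" for x
    have finB: "finite (B x)" for x using finite_doubles by (simp add: B_def)
    have "card (B x) \<le> 2" if x: "x \<in> S" for x
    proof -
      have "x \<in> doubles" using x S(1) P by (meson subsetD)
      then obtain u v where "B x \<subseteq> {u, v}" using block_colours[of x] unfolding B_def by blast
      then have "card (B x) \<le> card {u, v}" by (intro card_mono) auto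
      also have "\<dots> \<le> 2" by (simp add: card_insert_le_m1)
      finally show ?thesis .
    qed
    then have "(\<Sum>x\<in>S. card (B x)) \<le> (\<Sum>x\<in>S. 2)" by (rule sum_mono)
    then have "card (\<Union>x\<in>S. B x) \<le> 4" using card_UN_le[OF S(2), of B] S(3) by simp
    moreover have "paired T \<subseteq> (\<Union>x\<in>S. B x)"
    proof
      fix y assume y: "y \<in> paired T"
      then obtain x where "x \<in> S" "rows y = rows x" "cols y = cols x" using * by (meson)
      moreover have "y \<in> doubles" using y P by (rule subsetD[rotated])
      ultimately show "y \<in> (\<Union>x\<in>S. B x)" by (auto simp: B_def)
    qed
    ultimately show False
      using six_paired[OF T] card_mono[of "\<Union>x\<in>S. B x" "paired T"] S(2) finB by fastforce
  qed
  obtain x where x: "x \<in> paired T" using pick[of "{}"] by auto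
  obtain y where y: "y \<in> paired T" "\<not> (rows y = rows x \<and> cols y = cols x)" using pick[of "{x}"] x by auto
  obtain z where z: "z \<in> paired T" "\<forall>w\<in>{x, y}. \<not> (rows z = rows w \<and> cols z = cols w)"
    using pick[of "{x, y}"] x y by (auto simp: card_insert_le_m1)
  show ?thesis using that[of x y z] x y z by auto
qed

end

section \<open>The remaining doubles as a search problem\<close>

text \<open>The rows and columns of the grid, renamed.  Constructors instead of numbers make equality
decidable by a single rewriting step.\<close>
datatype row = R0 | R1 | R2 | R3 | R4 | R5
datatype col = C0 | C1 | C2 | C3 | C4 | C5 | C6
datatype line = Row row | Col col

text \<open>A pair of cells, the first in row \<open>a\<close> and column \<open>b\<close> and the second in row \<open>c\<close> and column \<open>d\<close> of
\<open>Quad a b c d\<close>.  A block is represented by one of its two diagonals.\<close>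
datatype quad = Quad row col row col

fun on :: "line \<Rightarrow> quad \<Rightarrow> bool" where
  "on (Row r) (Quad a b c d) \<longleftrightarrow> r = a \<or> r = c"
| "on (Col s) (Quad a b c d) \<longleftrightarrow> s = b \<or> s = d"

fun share_row :: "quad \<Rightarrow> quad \<Rightarrow> bool" where
  "share_row (Quad a b c d) (Quad a' b' c' d') \<longleftrightarrow> (a = a' \<or> a = c') \<or> (c = a' \<or> c = c')"

fun share_col :: "quad \<Rightarrow> quad \<Rightarrow> bool" where
  "share_col (Quad a b c d) (Quad a' b' c' d') \<longleftrightarrow> (b = b' \<or> b = d') \<or> (d = b' \<or> d = d')"

fun overlap :: "quad \<Rightarrow> quad \<Rightarrow> bool" where
  "overlap (Quad a b c d) (Quad a' b' c' d') \<longleftrightarrow>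
     ((a = a' \<and> b = b') \<or> (a = c' \<and> b = d')) \<or> ((c = a' \<and> d = b') \<or> (c = c' \<and> d = d'))"

fun sees_both :: "quad \<Rightarrow> quad \<Rightarrow> bool" where
  "sees_both k (Quad a b c d) \<longleftrightarrow> (on (Row a) k \<or> on (Col b) k) \<and> (on (Row c) k \<or> on (Col d) k)"

text \<open>A block occupies every cell in which one of its rows meets one of its columns, so no other colour can
have a cell there.\<close>
fun avoids :: "quad \<Rightarrow> quad \<Rightarrow> bool" where
  "avoids k (Quad a b c d) \<longleftrightarrow> \<not> (on (Row a) k \<and> on (Col b) k) \<and> \<not> (on (Row c) k \<and> on (Col d) k)"

text \<open>What is required of two doubles in the presence of the blocks \<open>ks\<close>.  The last condition holds
because a colour of a block already sees both cells of its twin, and by \<open>sum_seen_le\<close> it cannot see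
both cells of two further doubles.\<close>
definition compatible :: "quad list \<Rightarrow> quad \<Rightarrow> quad \<Rightarrow> bool" where
  "compatible ks x y \<longleftrightarrow> (share_row x y \<or> share_col x y) \<and> \<not> overlap x y \<and>
     \<not> (\<exists>k\<in>set ks. sees_both k x \<and> sees_both k y)"

type_synonym demand = "line \<times> nat"

definition solution :: "quad list \<Rightarrow> demand list \<Rightarrow> quad list \<Rightarrow> quad set \<Rightarrow> bool" where
  "solution ks ds cs S \<longleftrightarrow> S \<subseteq> set cs \<and> (\<forall>x\<in>S. \<forall>y\<in>S. x \<noteq> y \<longrightarrow> compatible ks x y) \<and>
     (\<forall>(l, n)\<in>set ds. n \<le> card {x \<in> S. on l x})"

section \<open>A verified exhaustive search\<close>

text \<open>The search picks a line whose demand leaves the fewest candidates to spare, and branches on whether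
the first candidate on that line belongs to the solution.  It is evaluated by innermost rewriting,
which would evaluate both branches of a conditional; therefore all case distinctions that guard a
recursive call are made by pattern matching on an argument that is evaluated first.\<close>
fun cons_if :: "bool \<Rightarrow> 'a \<Rightarrow> 'a list \<Rightarrow> 'a list" where
  "cons_if True x xs = x # xs"
| "cons_if False x xs = xs"

text \<open>The blocks that see both cells of \<open>x\<close> are determined once per branching; by \<open>compatible\<close> none of them
may see both cells of another member of the solution.\<close>
fun seers :: "quad \<Rightarrow> quad list \<Rightarrow> quad list" where
  "seers x [] = []"
| "seers x (k # ks) = cons_if (sees_both k x) k (seers x ks)"

fun unseen :: "quad list \<Rightarrow> quad \<Rightarrow> bool" where
  "unseen [] y = True"
| "unseen (k # ks) y \<longleftrightarrow> \<not> sees_both k y \<and> unseen ks y"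

fun meets :: "bool \<Rightarrow> quad \<Rightarrow> quad \<Rightarrow> bool" where
  "meets True x y = True"
| "meets False x y = share_col x y"

fun fits :: "bool \<Rightarrow> quad list \<Rightarrow> quad \<Rightarrow> quad \<Rightarrow> bool" where
  "fits False ks x y = False"
| "fits True ks x y \<longleftrightarrow> \<not> overlap x y \<and> unseen ks y"

fun keep :: "quad list \<Rightarrow> quad \<Rightarrow> quad list \<Rightarrow> quad list" where
  "keep ks x [] = []"
| "keep ks x (y # ys) = cons_if (fits (meets (share_row x y) x y) ks x y) y (keep ks x ys)"

fun bump :: "bool \<Rightarrow> nat \<Rightarrow> nat" where
  "bump True n = Suc n"
| "bump False n = n"

fun count_on :: "line \<Rightarrow> quad list \<Rightarrow> nat" where
  "count_on l [] = 0"
| "count_on l (x # xs) = bump (on l x) (count_on l xs)"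

text \<open>Subtraction that reports a negative result by \<^const>\<open>None\<close>; it also serves as the comparison
in \<open>smaller\<close> and \<open>tightest\<close>.\<close>
fun spare :: "nat \<Rightarrow> nat \<Rightarrow> nat option" where
  "spare k 0 = Some k"
| "spare 0 (Suc n) = None"
| "spare (Suc k) (Suc n) = spare k n"

fun cons_option :: "'a \<Rightarrow> 'a list option \<Rightarrow> 'a list option" where
  "cons_option t None = None"
| "cons_option t (Some ts) = Some (t # ts)"

text \<open>For each demand, the number of candidates that could be given up on its line; \<^const>\<open>None\<close> if
some demand exceeds the number of candidates.\<close>
fun slacks :: "demand list \<Rightarrow> quad list \<Rightarrow> (line \<times> nat) list option"
  and slacks_from :: "nat option \<Rightarrow> line \<Rightarrow> demand list \<Rightarrow> quad list \<Rightarrow> (line \<times> nat) list option" where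
  "slacks [] cs = Some []"
| "slacks ((l, n) # ds) cs = slacks_from (spare (count_on l cs) n) l ds cs"
| "slacks_from None l ds cs = None"
| "slacks_from (Some s) l ds cs = cons_option (l, s) (slacks ds cs)"

fun smaller :: "line \<times> nat \<Rightarrow> line \<times> nat \<Rightarrow> nat option \<Rightarrow> line \<times> nat" where
  "smaller p q None = q"
| "smaller p q (Some s) = p"

fun tightest :: "line \<times> nat \<Rightarrow> (line \<times> nat) list \<Rightarrow> line" where
  "tightest p [] = fst p"
| "tightest p (q # ts) = tightest (smaller p q (spare (snd q) (snd p))) ts"

fun pull :: "line \<Rightarrow> quad list \<Rightarrow> quad list \<Rightarrow> (quad \<times> quad list) option"
  and pull_from :: "bool \<Rightarrow> line \<Rightarrow> quad list \<Rightarrow> quad \<Rightarrow> quad list \<Rightarrow> (quad \<times> quad list) option" where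
  "pull l acc [] = None"
| "pull l acc (x # xs) = pull_from (on l x) l acc x xs"
| "pull_from True l acc x xs = Some (x, acc @ xs)"
| "pull_from False l acc x xs = pull l (x # acc) xs"

fun demand :: "line \<Rightarrow> nat \<Rightarrow> demand list \<Rightarrow> demand list" where
  "demand l 0 ds = ds"
| "demand l (Suc n) ds = (l, Suc n) # ds"

fun lower :: "bool \<Rightarrow> nat \<Rightarrow> nat" where
  "lower False n = n"
| "lower True n = n - 1"

fun remaining_demands :: "quad \<Rightarrow> demand list \<Rightarrow> demand list" where
  "remaining_demands x [] = []"
| "remaining_demands x ((l, n) # ds) = demand l (lower (on l x) n) (remaining_demands x ds)"

lemma pull_Some:
  "pull l acc cs = Some (x, rest) \<Longrightarrow>
    set (acc @ cs) = insert x (set rest) \<and> length (acc @ cs) = Suc (length rest)"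
proof (induction cs arbitrary: acc)
  case (Cons y cs)
  show ?case
  proof (cases "on l y")
    case False
    then have "pull l (y # acc) cs = Some (x, rest)" using Cons.prems by simp
    from Cons.IH[OF this] show ?thesis by auto
  qed (use Cons.prems in auto)
qed simp

lemma cons_if_eq: "cons_if b x xs = (if b then x # xs else xs)"
  by (cases b) auto

lemma unseen_seers_iff: "unseen (seers x ks) y \<longleftrightarrow> \<not> (\<exists>k\<in>set ks. sees_both k x \<and> sees_both k y)"
  by (induction ks) (auto simp: cons_if_eq)

lemma meets_iff: "meets (share_row x y) x y \<longleftrightarrow> share_row x y \<or> share_col x y"
  by (cases "share_row x y") auto

lemma keep_seers: "keep (seers x ks) x ys = filter (compatible ks x) ys"
proof (induction ys)
  case (Cons y ys)
  have "fits b ks' x y \<longleftrightarrow> b \<and> \<not> overlap x y \<and> unseen ks' y" for b ks' by (cases b) auto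
  then have "fits (meets (share_row x y) x y) (seers x ks) x y \<longleftrightarrow> compatible ks x y"
    by (simp add: meets_iff unseen_seers_iff compatible_def)
  then show ?case using Cons by (simp add: cons_if_eq)
qed simp

function refutes :: "quad list \<Rightarrow> demand list \<Rightarrow> quad list \<Rightarrow> bool"
  and refutes_on :: "(line \<times> nat) list option \<Rightarrow> quad list \<Rightarrow> demand list \<Rightarrow> quad list \<Rightarrow> bool"
  and refutes_by :: "(quad \<times> quad list) option \<Rightarrow> quad list \<Rightarrow> demand list \<Rightarrow> bool" where
  "refutes ks ds cs = refutes_on (slacks ds cs) ks ds cs"
| "refutes_on None ks ds cs = True"
| "refutes_on (Some []) ks ds cs = False"
| "refutes_on (Some (p # ps)) ks ds cs = refutes_by (pull (tightest p ps) [] cs) ks ds"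
| "refutes_by None ks ds = False"
| "refutes_by (Some (x, cs)) ks ds \<longleftrightarrow>
    refutes ks (remaining_demands x ds) (keep (seers x ks) x cs) \<and> refutes ks ds cs"
  by pat_completeness auto
\<comment> \<open>A call of \<^const>\<open>refutes\<close> passes through the two other functions before the list of candidates
  becomes shorter; the factor 3 leaves room for these intermediate steps.\<close>
termination
proof (relation "measure (\<lambda>p. case p of
    Inl (ks, ds, cs) \<Rightarrow> 3 * length cs + 2
  | Inr (Inl (v, ks, ds, cs)) \<Rightarrow> 3 * length cs + 1
  | Inr (Inr (q, ks, ds)) \<Rightarrow> (case q of None \<Rightarrow> 0 | Some (x, cs) \<Rightarrow> 3 * length cs + 3))", goal_cases)
  case (3 p ps ks ds cs)
  then show ?case by (auto split: option.split dest: pull_Some)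
next
  case (4 x cs ks ds)
  then show ?case using length_filter_le[of "compatible ks x" cs] by (simp add: keep_seers le_imp_less_Suc)
qed auto

lemma card_on_le_count_on:
  assumes "S \<subseteq> set cs"
  shows "card {x \<in> S. on l x} \<le> count_on l cs"
proof -
  have bump: "bump b n = (if b then Suc n else n)" for b n by (cases b) auto
  have "count_on l cs = length (filter (on l) cs)" by (induction cs) (auto simp: bump)
  moreover have "card {x \<in> S. on l x} \<le> card (set (filter (on l) cs))"
    using assms by (intro card_mono) auto
  ultimately show ?thesis using card_length[of "filter (on l) cs"] by simp
qed

lemma slacks_None: "slacks ds cs = None \<Longrightarrow> \<exists>(l, n)\<in>set ds. count_on l cs < n"
proof (induction ds)
  case (Cons p ds)
  obtain l n where p: "p = (l, n)" by (cases p)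
  have spare: "spare k n = None \<Longrightarrow> k < n" for k n by (induction k n rule: spare.induct) auto
  show ?case
  proof (cases "spare (count_on l cs) n")
    case None
    then show ?thesis using spare p by auto
  next
    case (Some s)
    then have "slacks ds cs = None" using Cons.prems p by (cases "slacks ds cs") auto
    then show ?thesis using Cons.IH by auto
  qed
qed simp

lemma solution_remaining_demands:
  assumes S: "solution ks ds (x # cs) S" "x \<in> S"
  shows "solution ks (remaining_demands x ds) (filter (compatible ks x) cs) (S - {x})"
proof -
  have fin: "finite S" using S(1) finite_subset by (auto simp: solution_def)
  have demand: "(l, n) \<in> set (demand l' k ds') \<Longrightarrow> (l, n) \<in> set ds' \<or> l = l' \<and> n = k" for l n l' k ds'
    by (cases k) auto
  have lower: "lower b n = (if b then n - 1 else n)" for b n by (cases b) auto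
  have paid: "n \<le> card {y \<in> S - {x}. on l y}"
    if "(l, n) \<in> set (remaining_demands x ds)" "\<forall>(l, n)\<in>set ds. n \<le> card {y \<in> S. on l y}" for l n ds
    using that
  proof (induction ds)
    case (Cons p ds)
    obtain l' n' where p: "p = (l', n')" by (cases p)
    have eq: "{y \<in> S - {x}. on l' y} = {y \<in> S. on l' y} - {x}" by auto
    show ?case
    proof (cases "(l, n) \<in> set (remaining_demands x ds)")
      case False
      then have "l = l'" "n = lower (on l' x) n'" using Cons.prems(1) p demand by fastforce+
      then show ?thesis using Cons.prems(2) p eq S(2) fin by (auto simp: lower)
    qed (use Cons in auto)
  qed simp
  show ?thesis
    using S paid unfolding solution_def by auto
qed

text \<open>Induction along the search.  If a solution contains the candidate \<open>x\<close> on which the search branches,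
then removing \<open>x\<close> leaves a solution of the reduced problem (\<open>solution_remaining_demands\<close>); otherwise it is a
solution without the candidate \<open>x\<close>.\<close>
theorem refutes_sound:
  "refutes ks ds cs \<Longrightarrow> \<not> solution ks ds cs S"
  "refutes_on v ks ds cs \<Longrightarrow> v = slacks ds cs \<Longrightarrow> \<not> solution ks ds cs S"
  "refutes_by q ks ds \<Longrightarrow> q = Some (x, rest) \<Longrightarrow> \<not> solution ks ds (x # rest) S"
proof (induction ks ds cs and v ks ds cs and q ks ds arbitrary: S and S and S x rest
    rule: refutes_refutes_on_refutes_by.induct)
  case (2 ks ds cs)
  then obtain l n where ln: "(l, n) \<in> set ds" "count_on l cs < n"
    using slacks_None[of ds cs] by auto
  show ?case
  proof
    assume "solution ks ds cs S"
    then have "n \<le> card {x \<in> S. on l x}" "S \<subseteq> set cs" using ln(1) by (auto simp: solution_def)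
    then show False using card_on_le_count_on[of S cs l] ln(2) by simp
  qed
next
  case (3 ks ds cs)
  from "3.prems"(1) show ?case by simp
next
  case (4 p ps ks ds cs)
  have r: "refutes_by (pull (tightest p ps) [] cs) ks ds" using "4.prems"(1) by simp
  then obtain x rest where q: "pull (tightest p ps) [] cs = Some (x, rest)"
    by (cases "pull (tightest p ps) [] cs") auto
  have "\<not> solution ks ds (x # rest) S" using "4.IH"[OF r q] .
  moreover have "set cs = set (x # rest)" using pull_Some[OF q] by simp
  ultimately show ?case by (simp add: solution_def)
next
  case (6 y cs ks ds)
  then have eq: "y = x" "cs = rest" by auto
  show ?case
  proof
    assume S: "solution ks ds (x # rest) S"
    show False
    proof (cases "x \<in> S")
      case True
      then show ?thesis using solution_remaining_demands[OF S] 6 eq by (simp add: keep_seers)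
    next
      case False
      then have "solution ks ds rest S" using S by (auto simp: solution_def)
      then show ?thesis using 6 eq by simp
    qed
  qed
qed auto

section \<open>The six search problems\<close>

definition all_rows :: "row list" where "all_rows = [R0, R1, R2, R3, R4, R5]"
definition all_cols :: "col list" where "all_cols = [C0, C1, C2, C3, C4, C5, C6]"

fun ordered_pairs :: "'a list \<Rightarrow> ('a \<times> 'a) list" where
  "ordered_pairs [] = []"
| "ordered_pairs (x # xs) = map (Pair x) xs @ ordered_pairs xs"

text \<open>The two diagonals of each 2 by 2 subgrid in the rows \<open>a\<close> and \<open>c\<close>.\<close>
fun quads_in :: "row \<times> row \<Rightarrow> (col \<times> col) list \<Rightarrow> quad list" where
  "quads_in (a, c) [] = []"
| "quads_in (a, c) ((b, d) # qs) = Quad a b c d # Quad a d c b # quads_in (a, c) qs"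

fun quads :: "(row \<times> row) list \<Rightarrow> (col \<times> col) list \<Rightarrow> quad list" where
  "quads [] qs = []"
| "quads (p # ps) qs = quads_in p qs @ quads ps qs"

fun admissible :: "quad list \<Rightarrow> quad \<Rightarrow> bool" where
  "admissible [] x = True"
| "admissible (k # ks) x \<longleftrightarrow> (share_row k x \<or> share_col k x) \<and> avoids k x \<and> admissible ks x"

fun sieve :: "quad list \<Rightarrow> quad list \<Rightarrow> quad list" where
  "sieve ks [] = []"
| "sieve ks (x # xs) = cons_if (admissible ks x) x (sieve ks xs)"

definition candidates :: "quad list \<Rightarrow> quad list" where
  "candidates ks = sieve ks (quads (ordered_pairs all_rows) (ordered_pairs all_cols))"

fun demands_on :: "nat \<Rightarrow> quad list \<Rightarrow> line list \<Rightarrow> demand list" where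
  "demands_on n ks [] = []"
| "demands_on n ks (l # ls) = demand l (n - 2 * count_on l ks) (demands_on n ks ls)"

text \<open>Of 15 doubles at least three meet a given row and two a given column, as there are only four other
colours.  Each block contributes two doubles to each of its lines, and truncated subtraction
discards the demands that the blocks satisfy alone.\<close>
definition demands :: "quad list \<Rightarrow> demand list" where
  "demands ks = demands_on 3 ks (map Row all_rows) @ demands_on 2 ks (map Col all_cols)"

definition impossible :: "quad list \<Rightarrow> bool" where
  "impossible ks \<longleftrightarrow> refutes ks (demands ks) (candidates ks)"

lemma ordered_pairs_total: "x \<in> set xs \<Longrightarrow> y \<in> set xs \<Longrightarrow> x \<noteq> y \<Longrightarrow>
    (x, y) \<in> set (ordered_pairs xs) \<or> (y, x) \<in> set (ordered_pairs xs)"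
  by (induction xs) auto

lemma in_all: "r \<in> set all_rows" "s \<in> set all_cols"
  by (cases r; simp add: all_rows_def) (cases s; simp add: all_cols_def)

text \<open>Only one of the two orders in which a pair of cells can be listed occurs among the candidates.\<close>
lemma in_candidates:
  assumes "a \<noteq> c" "b \<noteq> d" and adm: "\<And>q. q = Quad a b c d \<or> q = Quad c d a b \<Longrightarrow> admissible ks q"
  shows "Quad a b c d \<in> set (candidates ks) \<or> Quad c d a b \<in> set (candidates ks)"
proof -
  have in_quads: "(a, c) \<in> set ps \<Longrightarrow> (b, d) \<in> set qs \<Longrightarrow> {Quad a b c d, Quad a d c b} \<subseteq> set (quads ps qs)"
    for a b c d ps qs
  proof (induction ps)
    case (Cons p ps)
    have "(b, d) \<in> set qs \<Longrightarrow> {Quad a b c d, Quad a d c b} \<subseteq> set (quads_in (a, c) qs)" for qs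
      by (induction qs) auto
    then show ?case using Cons by auto
  qed simp
  let ?q = "quads (ordered_pairs all_rows) (ordered_pairs all_cols)"
  have "(a, c) \<in> set (ordered_pairs all_rows) \<or> (c, a) \<in> set (ordered_pairs all_rows)"
    "(b, d) \<in> set (ordered_pairs all_cols) \<or> (d, b) \<in> set (ordered_pairs all_cols)"
    using ordered_pairs_total in_all assms(1,2) by metis+
  then have "Quad a b c d \<in> set ?q \<or> Quad c d a b \<in> set ?q" using in_quads by blast
  moreover have "set (sieve ks xs) = {x \<in> set xs. admissible ks x}" for xs
    by (induction xs) (auto simp: cons_if_eq)
  ultimately show ?thesis using adm by (auto simp: candidates_def)
qed

lemma in_demands_on: "(l, n) \<in> set (demands_on m ks ls) \<Longrightarrow> l \<in> set ls \<and> n = m - 2 * count_on l ks"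
proof (induction ls)
  case (Cons l' ls)
  then show ?case by (cases "m - 2 * count_on l' ks") auto
qed simp

text \<open>The equations by which the search is run: its defining equations, the truth tables of the
connectives, and arithmetic in terms of \<^const>\<open>Suc\<close>.\<close>
lemmas search_eval =
  impossible_def demands_def demands_on.simps candidates_def quads.simps quads_in.simps
  all_rows_def all_cols_def ordered_pairs.simps sieve.simps admissible.simps avoids.simps
  refutes.simps refutes_on.simps refutes_by.simps remaining_demands.simps lower.simps demand.simps pull.simps pull_from.simps
  tightest.simps smaller.simps slacks.simps slacks_from.simps cons_option.simps spare.simps
  count_on.simps bump.simps keep.simps fits.simps meets.simps seers.simps unseen.simps cons_if.simps
  sees_both.simps overlap.simps share_row.simps share_col.simps on.simps row.distinct col.distinct
  list.map append.simps fst_conv snd_conv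
  HOL.simp_thms(6) not_True_eq_False not_False_eq_True HOL.simp_thms(21-24,29-32)
  numeral_2_eq_2 numeral_3_eq_3 One_nat_def mult_0 mult_Suc add_Suc add_0_left
  diff_Suc_Suc diff_0_eq_0 minus_nat.diff_0

text \<open>The three blocks share lines pairwise.  In the names below, a star consists of three blocks on one
common line and a triangle of three blocks in which each pair shares another line of the same kind;
in a row path two pairs of blocks share a row and the third pair a column, and in a column path it
is the other way round.\<close>
lemma impossible_row_star: "impossible [Quad R0 C0 R1 C1, Quad R0 C2 R2 C3, Quad R0 C4 R3 C5]"
  by (simp only: search_eval)

lemma impossible_row_triangle: "impossible [Quad R0 C0 R1 C1, Quad R0 C2 R2 C3, Quad R1 C4 R2 C5]"
  by (simp only: search_eval)

lemma impossible_row_path: "impossible [Quad R0 C0 R1 C1, Quad R0 C2 R2 C3, Quad R1 C2 R3 C4]"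
  by (simp only: search_eval)

lemma impossible_col_path: "impossible [Quad R0 C0 R1 C1, Quad R0 C2 R2 C3, Quad R3 C0 R4 C2]"
  by (simp only: search_eval)

lemma impossible_col_star: "impossible [Quad R0 C0 R1 C1, Quad R2 C0 R3 C2, Quad R4 C0 R5 C3]"
  by (simp only: search_eval)

lemma impossible_col_triangle: "impossible [Quad R0 C0 R1 C1, Quad R2 C0 R3 C2, Quad R4 C1 R5 C2]"
  by (simp only: search_eval)

section \<open>From colourings to the search problems\<close>

text \<open>Used to rename the rows and columns of a given arrangement of blocks to \<open>R0\<close>, \<open>R1\<close>, \<dots> and
\<open>C0\<close>, \<open>C1\<close>, \<dots> as they occur in the searched arrangements.\<close>
lemma extend_to_bijection:
  assumes "finite A" "card A = card (UNIV :: 'b::finite set)"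
    and xs: "distinct xs" "set xs \<subseteq> A" and ys: "distinct (ys :: 'b list)" "length ys = length xs"
  shows "\<exists>g. bij_betw g A UNIV \<and> map g xs = ys"
proof -
  have "card (A - set xs) = card (UNIV - set ys)"
    using assms by (simp add: card_Diff_subset distinct_card)
  then obtain h where h: "bij_betw h (A - set xs) (UNIV - set ys)"
    using assms(1) finite_same_card_bij[of "A - set xs" "UNIV - set ys"] by auto
  define k where "k = (\<lambda>x. the (map_of (zip xs ys) x))"
  have map_k: "map k xs = ys"
    using xs ys by (intro nth_equalityI) (auto simp: k_def map_of_zip_nth)
  have "bij_betw k (set xs) (set ys)"
    unfolding bij_betw_def
  proof
    have "distinct (map k xs)" unfolding map_k by (rule ys(1))
    then show "inj_on k (set xs)" by (simp add: distinct_map)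
    show "k ` set xs = set ys" unfolding map_k[symmetric] by simp
  qed
  then have "bij_betw (\<lambda>x. if x \<in> set xs then k x else h x) (set xs \<union> (A - set xs)) (set ys \<union> (UNIV - set ys))"
    using h by (intro bij_betw_disjoint_Un) auto
  moreover have "set xs \<union> (A - set xs) = A" using xs(2) by blast
  moreover have "map (\<lambda>x. if x \<in> set xs then k x else h x) xs = ys"
    unfolding map_k[symmetric] by simp
  ultimately show ?thesis by (intro exI[of _ "\<lambda>x. if x \<in> set xs then k x else h x"]) auto
qed

lemma UNIV_row: "(UNIV :: row set) = set all_rows" and UNIV_col: "(UNIV :: col set) = set all_cols"
  using in_all by auto

instance row :: finite by standard (simp add: UNIV_row)
instance col :: finite by standard (simp add: UNIV_col)

lemma card_UNIV_row: "card (UNIV :: row set) = 6" and card_UNIV_col: "card (UNIV :: col set) = 7"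
  by (simp_all add: UNIV_row UNIV_col all_rows_def all_cols_def)

lemma on_iff: "on l (Quad a b c d) \<longleftrightarrow> l \<in> {Row a, Row c, Col b, Col d}"
  by (cases l) auto

lemma share_iff: "share_row x y \<or> share_col x y \<longleftrightarrow> (\<exists>l. on l x \<and> on l y)"
  by (cases x; cases y) (auto simp: on_iff)

context grid_colouring
begin

lemma double_cells:
  assumes "z \<in> doubles"
  obtains i j i' j' where "i < 6" "j < 7" "i' < 6" "j' < 7" "i \<noteq> i'" "j \<noteq> j'"
    "f i j = z" "f i' j' = z" "rows z = {i, i'}" "cols z = {j, j'}"
proof -
  obtain p q where pq: "cells z = {p, q}" "p \<noteq> q"
    using double_sizes[OF assms] unfolding card_2_iff by blast
  obtain i j where c1: "p = (i, j)" by (cases p)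
  obtain i' j' where c2: "q = (i', j')" by (cases q)
  note c = c1 c2
  have "(i, j) \<in> cells z" "(i', j') \<in> cells z" using pq(1) c by auto
  then have cell: "i < 6" "j < 7" "i' < 6" "j' < 7" "f i j = z" "f i' j' = z"
    by (auto simp: cells_def)
  have rc: "rows z = {i, i'}" "cols z = {j, j'}" using pq(1) c by (auto simp: rows_def cols_def)
  then have "i \<noteq> i'" "j \<noteq> j'" using double_sizes[OF assms] by auto
  with that[OF cell(1-4) _ _ cell(5,6) rc] show ?thesis .
qed

text \<open>The bijections \<open>r\<close> and \<open>s\<close> rename rows and columns, and the list \<open>ks\<close> describes the blocks of the
colours \<open>xs\<close> in the new names.  The doubles in \<open>T\<close> outside these blocks form a solution of the search
problem for \<open>ks\<close>.\<close>
lemma no_impossible_blocks: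
  fixes r :: "nat \<Rightarrow> row" and s :: "nat \<Rightarrow> col"
  defines "lines \<equiv> \<lambda>x. Row ` r ` rows x \<union> Col ` s ` cols x"
  assumes T: "T \<subseteq> doubles" "card T = 15" and xs: "set xs \<subseteq> paired T"
    and r: "bij_betw r {..<6} UNIV" and s: "bij_betw s {..<7} UNIV"
    and ks: "list_all2 (\<lambda>x k. \<forall>l. on l k \<longleftrightarrow> l \<in> lines x) xs ks"
  shows "\<not> impossible ks"
proof
  assume imp: "impossible ks"
  have TC: "T \<subseteq> C" using T doubles_subset by blast
  have finT: "finite T" using T finite_doubles finite_subset by blast
  have w: "card (C - T) = 4"
    using T TC card_colours finite_C by (simp add: card_Diff_subset finite_subset)
  have inj_r: "r i = r i' \<longleftrightarrow> i = i'" if "i < 6" "i' < 6" for i i'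
    using r that by (auto simp: bij_betw_def inj_on_def)
  have inj_s: "s j = s j' \<longleftrightarrow> j = j'" if "j < 7" "j' < 7" for j j'
    using s that by (auto simp: bij_betw_def inj_on_def)
  have row_line: "Row (r i) \<in> lines x \<longleftrightarrow> i \<in> rows x" if "i < 6" for i x
  proof -
    have "Row (r i) \<in> lines x \<longleftrightarrow> (\<exists>i'\<in>rows x. r i = r i')" by (auto simp: lines_def)
    also have "\<dots> \<longleftrightarrow> (\<exists>i'\<in>rows x. i = i')"
      using inj_r[OF that] by (intro bex_cong refl) (simp add: in_rows)
    finally show ?thesis by simp
  qed
  have col_line: "Col (s j) \<in> lines x \<longleftrightarrow> j \<in> cols x" if "j < 7" for j x
  proof -
    have "Col (s j) \<in> lines x \<longleftrightarrow> (\<exists>j'\<in>cols x. s j = s j')" by (auto simp: lines_def)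
    also have "\<dots> \<longleftrightarrow> (\<exists>j'\<in>cols x. j = j')"
      using inj_s[OF that] by (intro bex_cong refl) (simp add: in_cols)
    finally show ?thesis by simp
  qed
  have common: "\<exists>l. l \<in> lines x \<and> l \<in> lines y" if "rows x \<inter> rows y \<noteq> {} \<or> cols x \<inter> cols y \<noteq> {}" for x y
    using that
  proof
    assume "rows x \<inter> rows y \<noteq> {}"
    then obtain i where "i \<in> rows x" "i \<in> rows y" by blast
    then have "Row (r i) \<in> lines x" "Row (r i) \<in> lines y" by (simp_all add: lines_def)
    then show ?thesis by blast
  next
    assume "cols x \<inter> cols y \<noteq> {}"
    then obtain j where "j \<in> cols x" "j \<in> cols y" by blast
    then have "Col (s j) \<in> lines x" "Col (s j) \<in> lines y" by (simp_all add: lines_def)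
    then show ?thesis by blast
  qed
  define B where "B x = {y \<in> T. rows y = rows x \<and> cols y = cols x}" for x
  define T' where "T' = T - (\<Union>x\<in>set xs. B x)"
  have T': "T' \<subseteq> T" "T' \<subseteq> doubles" using T by (auto simp: T'_def)
  have block: "\<exists>x\<in>set xs. \<forall>l. on l k \<longleftrightarrow> l \<in> lines x" if "k \<in> set ks" for k
    using ks that by (induction rule: list_all2_induct) auto
  define represents where "represents q z \<longleftrightarrow> (\<exists>i j i' j'. i < 6 \<and> j < 7 \<and> i' < 6 \<and> j' < 7 \<and>
      f i j = z \<and> f i' j' = z \<and> i \<noteq> i' \<and> j \<noteq> j' \<and> rows z = {i, i'} \<and> cols z = {j, j'} \<and>
      q = Quad (r i) (s j) (r i') (s j'))" for q z
  have on_rep: "on l q \<longleftrightarrow> l \<in> lines z" if "represents q z" for l q z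
    using that by (auto simp: represents_def on_iff lines_def)
  have adm: "admissible ks q" if q: "represents q z" and z: "z \<in> T'" for q z
  proof -
    have one: "(share_row k q \<or> share_col k q) \<and> avoids k q" if k: "k \<in> set ks" for k
    proof -
      obtain x where x: "x \<in> set xs" "\<And>l. on l k \<longleftrightarrow> l \<in> lines x" using block[OF k] by blast
      obtain x' where x': "x \<in> T" "x' \<in> T" "twins x x'" using x(1) xs by (auto simp: paired_def)
      have notB: "z \<noteq> x" "z \<noteq> x'" using z x(1) x' by (auto simp: T'_def B_def twins_def)
      have "rows x \<inter> rows z \<noteq> {} \<or> cols x \<inter> cols z \<noteq> {}"
        using lines_meet[of x z] notB x' z T' TC by blast
      then have "\<exists>l. on l k \<and> on l q" unfolding x(2) on_rep[OF q] by (rule common)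
      moreover have "avoids k q"
      proof -
        have "\<not> (Row (r i) \<in> lines x \<and> Col (s j) \<in> lines x)" if "f i j = z" "i < 6" "j < 7" for i j
          using block_cells[of x x' i j] x' notB T that row_line col_line by auto
        then show ?thesis using q x(2) by (auto simp: represents_def)
      qed
      ultimately show ?thesis by (simp add: share_iff)
    qed
    have "(\<forall>k\<in>set ks'. (share_row k q \<or> share_col k q) \<and> avoids k q) \<Longrightarrow> admissible ks' q" for ks'
      by (induction ks') auto
    then show ?thesis using one by blast
  qed
  have ex: "\<exists>q. represents q z \<and> q \<in> set (candidates ks)" if z: "z \<in> T'" for z
  proof -
    have "z \<in> doubles" using z T' by blast
    then obtain i j i' j' where c: "i < 6" "j < 7" "i' < 6" "j' < 7" "i \<noteq> i'" "j \<noteq> j'"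
      "f i j = z" "f i' j' = z" "rows z = {i, i'}" "cols z = {j, j'}"
      by (rule double_cells)
    have reps: "represents (Quad (r i) (s j) (r i') (s j')) z" "represents (Quad (r i') (s j') (r i) (s j)) z"
      unfolding represents_def
      by (rule exI[of _ i], rule exI[of _ j], rule exI[of _ i'], rule exI[of _ j'], use c in simp)
        (rule exI[of _ i'], rule exI[of _ j'], rule exI[of _ i], rule exI[of _ j], use c in auto)
    have "r i \<noteq> r i'" "s j \<noteq> s j'" using c inj_r inj_s by auto
    then have "Quad (r i) (s j) (r i') (s j') \<in> set (candidates ks) \<or> Quad (r i') (s j') (r i) (s j) \<in> set (candidates ks)"
      by (rule in_candidates) (use reps adm[OF _ z] in auto)
    then show ?thesis using reps by blast
  qed
  define quad_of where "quad_of z = (SOME q. represents q z \<and> q \<in> set (candidates ks))" for z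
  have rep: "represents (quad_of z) z" "quad_of z \<in> set (candidates ks)" if "z \<in> T'" for z
    using someI_ex[OF ex[OF that]] by (auto simp: quad_of_def)
  define S where "S = quad_of ` T'"
  have overlap: "z = z'" if "represents q z" "represents q' z'" "overlap q q'" for q q' z z'
    using that inj_r inj_s by (auto simp: represents_def)
  have "overlap q q" for q by (cases q) auto
  then have inj: "inj_on quad_of T'" using overlap rep by (metis inj_onI)
  have seen: "seen x z = 2"
    if qz: "represents q z" "sees_both k q" "\<And>l. on l k \<longleftrightarrow> l \<in> lines x" "z \<in> doubles" for q z k x
  proof -
    obtain i j i' j' where c: "i < 6" "j < 7" "i' < 6" "j' < 7" "f i j = z" "f i' j' = z" "i \<noteq> i'"
      "q = Quad (r i) (s j) (r i') (s j')" using qz(1) unfolding represents_def by blast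
    then have "{(i, j), (i', j')} \<subseteq> cells z \<inter> neighbourhood x"
      using qz(2,3) row_line col_line by (auto simp: cells_def neighbourhood_def)
    then have "card {(i, j), (i', j')} \<le> seen x z" by (intro card_mono) auto
    moreover have "seen x z \<le> card (cells z)" by (intro card_mono) auto
    ultimately show ?thesis using c double_sizes[OF qz(4)] by simp
  qed
  have compat: "compatible ks (quad_of z) (quad_of z')" if z: "z \<in> T'" "z' \<in> T'" "z \<noteq> z'" for z z'
  proof -
    have "rows z \<inter> rows z' \<noteq> {} \<or> cols z \<inter> cols z' \<noteq> {}" using lines_meet[of z z'] z T' TC by blast
    then have "\<exists>l. on l (quad_of z) \<and> on l (quad_of z')"
      unfolding on_rep[OF rep(1)[OF z(1)]] on_rep[OF rep(1)[OF z(2)]] by (rule common)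
    moreover have "\<not> overlap (quad_of z) (quad_of z')" using overlap rep z by blast
    moreover have False if k: "k \<in> set ks" "sees_both k (quad_of z)" "sees_both k (quad_of z')" for k
    proof -
      obtain x where x: "x \<in> set xs" "\<And>l. on l k \<longleftrightarrow> l \<in> lines x" using block[OF k(1)] by blast
      obtain x' where x': "x \<in> T" "x' \<in> T" "twins x x'" using x(1) xs by (auto simp: paired_def)
      have ne: "z \<noteq> x" "z \<noteq> x'" "z' \<noteq> x" "z' \<noteq> x'" "x \<noteq> x'"
        using z x(1) x' by (auto simp: T'_def B_def twins_def)
      have "seen x z = 2" "seen x z' = 2" using seen x(2) k rep z T' by blast+
      moreover have "seen x x' = 2"
      proof -
        have "cells x' \<subseteq> neighbourhood x"
          using x'(3) by (force simp: neighbourhood_def twins_def in_rows cells_def)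
        then show ?thesis using x' T double_sizes by (auto simp: Int_absorb2)
      qed
      moreover have "(\<Sum>y\<in>{x', z, z'}. seen x y) \<le> card {x', z, z'} + 2"
        using x' z T' T TC ne double_sizes by (intro sum_seen_le) auto
      ultimately show False using ne z(3) by simp
    qed
    ultimately show ?thesis by (auto simp: compatible_def share_iff)
  qed
  have B2: "card (B x) \<le> 2" if "x \<in> set xs" for x
  proof -
    have "x \<in> doubles" using that xs T by (auto simp: paired_def)
    then obtain u v where uv: "{y. y \<in> doubles \<and> rows y = rows x \<and> cols y = cols x} \<subseteq> {u, v}"
      by (rule block_colours)
    have "B x \<subseteq> {y. y \<in> doubles \<and> rows y = rows x \<and> cols y = cols x}" using T(1) by (auto simp: B_def)
    then have "B x \<subseteq> {u, v}" using uv by (rule order_trans)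
    then have "card (B x) \<le> card {u, v}" by (intro card_mono) auto
    also have "\<dots> \<le> 2" by (simp add: card_insert_le_m1)
    finally show ?thesis .
  qed
  have count: "card {z \<in> T. l \<in> lines z} \<le> card {q \<in> S. on l q} + 2 * count_on l ks" for l
  proof -
    let ?X = "filter (\<lambda>x. l \<in> lines x) xs"
    have bump: "bump b n = (if b then Suc n else n)" for b n by (cases b) auto
    have "count_on l ks = length ?X" using ks by (induction rule: list_all2_induct) (auto simp: bump)
    moreover have "card (\<Union>x\<in>set ?X. B x) \<le> 2 * length ?X"
    proof -
      have "card (\<Union>x\<in>set ?X. B x) \<le> (\<Sum>x\<in>set ?X. card (B x))" by (intro card_UN_le) simp
      also have "\<dots> \<le> (\<Sum>x\<in>set ?X. 2)" using B2 by (intro sum_mono) simp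
      also have "\<dots> \<le> 2 * length ?X" using card_length[of ?X] by simp
      finally show ?thesis .
    qed
    moreover have "{z \<in> T. l \<in> lines z} \<subseteq> {z \<in> T'. l \<in> lines z} \<union> (\<Union>x\<in>set ?X. B x)"
      by (auto simp: T'_def B_def lines_def)
    then have "card {z \<in> T. l \<in> lines z} \<le> card ({z \<in> T'. l \<in> lines z} \<union> (\<Union>x\<in>set ?X. B x))"
      using finT T' by (intro card_mono) (auto simp: B_def intro: finite_subset)
    then have "card {z \<in> T. l \<in> lines z} \<le> card {z \<in> T'. l \<in> lines z} + card (\<Union>x\<in>set ?X. B x)"
      using card_Un_le order_trans by blast
    moreover have "card {z \<in> T'. l \<in> lines z} \<le> card {q \<in> S. on l q}"
    proof (rule card_inj_on_le)
      show "inj_on quad_of {z \<in> T'. l \<in> lines z}" using inj by (rule inj_on_subset) auto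
      show "quad_of ` {z \<in> T'. l \<in> lines z} \<subseteq> {q \<in> S. on l q}" using on_rep rep by (auto simp: S_def)
      show "finite {q \<in> S. on l q}" using finT T' by (auto simp: S_def intro: finite_subset)
    qed
    ultimately show ?thesis by linarith
  qed
  have "n \<le> card {q \<in> S. on l q}" if d: "(l, n) \<in> set (demands ks)" for l n
  proof -
    consider "n = 3 - 2 * count_on l ks" "l \<in> range Row" | "n = 2 - 2 * count_on l ks" "l \<in> range Col"
      using d in_demands_on unfolding demands_def by fastforce
    then show ?thesis
    proof cases
      case 1
      then obtain i where i: "i < 6" "l = Row (r i)" using r unfolding bij_betw_def by (metis imageE lessThan_iff UNIV_I)
      then have "3 \<le> card {z \<in> T. l \<in> lines z}" using row_count_bounds(1)[OF TC w i(1)] row_line[OF i(1)] by simp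
      then show ?thesis using 1 count[of l] by linarith
    next
      case 2
      then obtain j where j: "j < 7" "l = Col (s j)" using s unfolding bij_betw_def by (metis imageE lessThan_iff UNIV_I)
      then have "2 \<le> card {z \<in> T. l \<in> lines z}" using col_count_bounds(1)[OF TC w j(1)] col_line[OF j(1)] by simp
      then show ?thesis using 2 count[of l] by linarith
    qed
  qed
  then have "solution ks (demands ks) (candidates ks) S"
    using compat rep unfolding solution_def S_def by auto
  then show False using refutes_sound(1) imp unfolding impossible_def by blast
qed

end

section \<open>Classification of three blocks\<close>

lemma meet_in_one:
  assumes "card A = 2" "card B = 2" "card (A \<inter> B) = 1"
  obtains p a b where "A = {p, a}" "B = {p, b}" "distinct [p, a, b]"
proof -
  obtain p where p: "A \<inter> B = {p}" using assms(3) by (auto simp: card_1_singleton_iff)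
  then have "p \<in> A" "p \<in> B" by blast+
  then have "card (A - {p}) = 1" "card (B - {p}) = 1" using assms(1,2) by (simp_all add: card_Diff_singleton)
  then obtain a b where ab: "A - {p} = {a}" "B - {p} = {b}" by (auto simp: card_1_singleton_iff)
  have "A = {p, a}" "B = {p, b}" "a \<noteq> p" "b \<noteq> p" using ab p by blast+
  moreover have "a \<noteq> b" using ab p by blast
  ultimately show ?thesis using that by simp
qed

lemma two_elements:
  assumes "card A = 2" obtains a b where "A = {a, b}" "a \<noteq> b"
  using assms by (auto simp: card_2_iff)

text \<open>Three edges of a graph that pairwise have one common end.\<close>
lemma star_or_triangle:
  assumes "card A = 2" "card B = 2" "card C = 2"
    and "card (A \<inter> B) = 1" "card (A \<inter> C) = 1" "card (B \<inter> C) = 1"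
  obtains (star) p a b c where "A = {p, a}" "B = {p, b}" "C = {p, c}" "distinct [p, a, b, c]"
  | (triangle) p a b where "A = {p, a}" "B = {p, b}" "C = {a, b}" "distinct [p, a, b]"
proof -
  obtain p a b where pab: "A = {p, a}" "B = {p, b}" "distinct [p, a, b]"
    using meet_in_one[OF assms(1,2,4)] .
  obtain c d where cd: "C = {c, d}" "c \<noteq> d" using two_elements[OF assms(3)] .
  show ?thesis
  proof (cases "p \<in> C")
    case True
    then obtain c where c: "C = {p, c}" "c \<noteq> p" using cd by auto
    have "c \<noteq> a" using assms(5) pab c by auto
    moreover have "c \<noteq> b" using assms(6) pab c by auto
    ultimately show ?thesis using star pab c by simp
  next
    case False
    have "A \<inter> C \<noteq> {}" "B \<inter> C \<noteq> {}" using assms(5,6) by auto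
    then have "a \<in> C" "b \<in> C" using False pab by auto
    then have "C = {a, b}" using cd pab by auto
    then show ?thesis using triangle pab by simp
  qed
qed

lemma path_ends:
  assumes "card A = 2" "card B = 2" "card C = 2"
    and "card (A \<inter> B) = 1" "card (A \<inter> C) = 1" "B \<inter> C = {}"
  obtains p q b c where "A = {p, q}" "B = {p, b}" "C = {q, c}" "distinct [p, q, b, c]"
proof -
  obtain p q b where pqb: "A = {p, q}" "B = {p, b}" "distinct [p, q, b]"
    using meet_in_one[OF assms(1,2,4)] .
  have "A \<inter> C \<noteq> {}" "p \<notin> C" "b \<notin> C" using assms(5,6) pqb by auto
  then have "q \<in> C" using pqb by auto
  moreover obtain c d where "C = {c, d}" "c \<noteq> d" using two_elements[OF assms(3)] .
  ultimately obtain c where "C = {q, c}" "c \<noteq> q" by auto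
  then show ?thesis using that pqb \<open>p \<notin> C\<close> \<open>b \<notin> C\<close> by auto
qed

context grid_colouring
begin

definition row_linked :: "nat \<Rightarrow> nat \<Rightarrow> bool" where
  "row_linked x y \<longleftrightarrow> card (rows x \<inter> rows y) = 1 \<and> cols x \<inter> cols y = {}"
definition col_linked :: "nat \<Rightarrow> nat \<Rightarrow> bool" where
  "col_linked x y \<longleftrightarrow> rows x \<inter> rows y = {} \<and> card (cols x \<inter> cols y) = 1"

lemma linked_commute: "row_linked x y \<longleftrightarrow> row_linked y x" "col_linked x y \<longleftrightarrow> col_linked y x"
  by (simp_all add: row_linked_def col_linked_def Int_commute)

text \<open>The lists \<open>il\<close> and \<open>jl\<close> contain the rows and columns that are occupied by the three blocks, \<open>rs\<close> and \<open>cs\<close>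
their new names.\<close>
lemma no_three_blocks:
  assumes T: "T \<subseteq> doubles" "card T = 15" and xyz: "x \<in> paired T" "y \<in> paired T" "z \<in> paired T"
    and il: "distinct il" "il \<noteq> []" "set il \<subseteq> {..<6}" "distinct rs" "length rs = length il"
    and jl: "distinct jl" "set jl \<subseteq> {..<7}" "distinct cs" "length cs = length jl"
    and imp: "impossible [kx, ky, kz]"
    and lines: "\<And>r s. map r il = rs \<Longrightarrow> map s jl = cs \<Longrightarrow> list_all2
      (\<lambda>u k. \<forall>l. on l k \<longleftrightarrow> l \<in> Row ` r ` rows u \<union> Col ` s ` cols u) [x, y, z] [kx, ky, kz]"
  shows False
proof -
  obtain r where r: "bij_betw r {..<6} (UNIV :: row set)" "map r il = rs"
    using extend_to_bijection[of "{..<6}" "il" rs] il card_UNIV_row by auto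
  obtain s where s: "bij_betw s {..<7} (UNIV :: col set)" "map s jl = cs"
    using extend_to_bijection[of "{..<7}" jl cs] jl card_UNIV_col by auto
  show False
    using no_impossible_blocks[OF T _ r(1) s(1) lines[OF r(2) s(2)]] xyz imp by auto
qed

lemma no_row_linked_triple:
  assumes T: "T \<subseteq> doubles" "card T = 15" and xyz: "x \<in> paired T" "y \<in> paired T" "z \<in> paired T"
    and links: "row_linked x y" "row_linked x z" "row_linked y z"
  shows False
proof -
  have c: "card (rows x) = 2" "card (rows y) = 2" "card (rows z) = 2"
    "card (cols x) = 2" "card (cols y) = 2" "card (cols z) = 2"
    using xyz T double_sizes by (auto simp: paired_def)
  obtain u u' where x: "cols x = {u, u'}" "u \<noteq> u'" using two_elements[OF c(4)] .
  obtain v v' where y: "cols y = {v, v'}" "v \<noteq> v'" using two_elements[OF c(5)] .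
  obtain w w' where z: "cols z = {w, w'}" "w \<noteq> w'" using two_elements[OF c(6)] .
  have jl: "distinct [u, u', v, v', w, w']" "set [u, u', v, v', w, w'] \<subseteq> {..<7}"
    using links x y z cols_subset[of x] cols_subset[of y] cols_subset[of z] by (auto simp: row_linked_def)
  have rr: "card (rows x \<inter> rows y) = 1" "card (rows x \<inter> rows z) = 1" "card (rows y \<inter> rows z) = 1"
    using links by (simp_all add: row_linked_def)
  show False
  proof (cases rule: star_or_triangle[OF c(1-3) rr])
    case (1 p a b d)
    show False
      by (rule no_three_blocks[OF T xyz, of "[p, a, b, d]" "[R0, R1, R2, R3]"
            "[u, u', v, v', w, w']" "[C0, C1, C2, C3, C4, C5]", OF _ _ _ _ _ jl _ _ impossible_row_star])
        (use 1 x y z rows_subset[of x] rows_subset[of y] rows_subset[of z] in \<open>auto simp: on_iff\<close>)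
  next
    case (2 p a b)
    show False
      by (rule no_three_blocks[OF T xyz, of "[p, a, b]" "[R0, R1, R2]"
            "[u, u', v, v', w, w']" "[C0, C1, C2, C3, C4, C5]", OF _ _ _ _ _ jl _ _ impossible_row_triangle])
        (use 2 x y z rows_subset[of x] rows_subset[of y] rows_subset[of z] in \<open>auto simp: on_iff\<close>)
  qed
qed

lemma no_col_linked_triple:
  assumes T: "T \<subseteq> doubles" "card T = 15" and xyz: "x \<in> paired T" "y \<in> paired T" "z \<in> paired T"
    and links: "col_linked x y" "col_linked x z" "col_linked y z"
  shows False
proof -
  have c: "card (rows x) = 2" "card (rows y) = 2" "card (rows z) = 2"
    "card (cols x) = 2" "card (cols y) = 2" "card (cols z) = 2"
    using xyz T double_sizes by (auto simp: paired_def)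
  obtain u u' where x: "rows x = {u, u'}" "u \<noteq> u'" using two_elements[OF c(1)] .
  obtain v v' where y: "rows y = {v, v'}" "v \<noteq> v'" using two_elements[OF c(2)] .
  obtain w w' where z: "rows z = {w, w'}" "w \<noteq> w'" using two_elements[OF c(3)] .
  have il: "distinct [u, u', v, v', w, w']" "[u, u', v, v', w, w'] \<noteq> []" "set [u, u', v, v', w, w'] \<subseteq> {..<6}"
    using links x y z rows_subset[of x] rows_subset[of y] rows_subset[of z] by (auto simp: col_linked_def)
  have cc: "card (cols x \<inter> cols y) = 1" "card (cols x \<inter> cols z) = 1" "card (cols y \<inter> cols z) = 1"
    using links by (simp_all add: col_linked_def)
  show False
  proof (cases rule: star_or_triangle[OF c(4-6) cc])
    case (1 p a b d)
    show False
      by (rule no_three_blocks[OF T xyz il, of "[R0, R1, R2, R3, R4, R5]"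
            "[p, a, b, d]" "[C0, C1, C2, C3]", OF _ _ _ _ _ _ impossible_col_star])
        (use 1 x y z cols_subset[of x] cols_subset[of y] cols_subset[of z] in \<open>auto simp: on_iff\<close>)
  next
    case (2 p a b)
    show False
      by (rule no_three_blocks[OF T xyz il, of "[R0, R1, R2, R3, R4, R5]"
            "[p, a, b]" "[C0, C1, C2]", OF _ _ _ _ _ _ impossible_col_triangle])
        (use 2 x y z cols_subset[of x] cols_subset[of y] cols_subset[of z] in \<open>auto simp: on_iff\<close>)
  qed
qed

lemma no_row_path:
  assumes T: "T \<subseteq> doubles" "card T = 15" and xyz: "x \<in> paired T" "y \<in> paired T" "z \<in> paired T"
    and links: "row_linked x y" "row_linked x z" "col_linked y z"
  shows False
proof -
  have c: "card (rows x) = 2" "card (rows y) = 2" "card (rows z) = 2"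
    "card (cols x) = 2" "card (cols y) = 2" "card (cols z) = 2"
    using xyz T double_sizes by (auto simp: paired_def)
  have "card (rows x \<inter> rows y) = 1" "card (rows x \<inter> rows z) = 1" "rows y \<inter> rows z = {}"
    using links by (simp_all add: row_linked_def col_linked_def)
  then obtain p q b d where rows: "rows x = {p, q}" "rows y = {p, b}" "rows z = {q, d}" "distinct [p, q, b, d]"
    using path_ends[OF c(1-3)] by blast
  obtain u u' where x: "cols x = {u, u'}" "u \<noteq> u'" using two_elements[OF c(4)] .
  have "card (cols y \<inter> cols z) = 1" using links by (simp add: col_linked_def)
  then obtain v w w' where yz: "cols y = {v, w}" "cols z = {v, w'}" "distinct [v, w, w']"
    using meet_in_one[OF c(5,6)] by blast
  show False
    by (rule no_three_blocks[OF T xyz, of "[p, q, b, d]" "[R0, R1, R2, R3]"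
          "[u, u', v, w, w']" "[C0, C1, C2, C3, C4]", OF _ _ _ _ _ _ _ _ _ impossible_row_path])
      (use links rows x yz rows_subset[of x] rows_subset[of y] rows_subset[of z]
        cols_subset[of x] cols_subset[of y] cols_subset[of z] in \<open>auto simp: on_iff row_linked_def\<close>)
qed

lemma no_col_path:
  assumes T: "T \<subseteq> doubles" "card T = 15" and xyz: "x \<in> paired T" "y \<in> paired T" "z \<in> paired T"
    and links: "row_linked x y" "col_linked x z" "col_linked y z"
  shows False
proof -
  have c: "card (rows x) = 2" "card (rows y) = 2" "card (rows z) = 2"
    "card (cols x) = 2" "card (cols y) = 2" "card (cols z) = 2"
    using xyz T double_sizes by (auto simp: paired_def)
  have "card (cols z \<inter> cols x) = 1" "card (cols z \<inter> cols y) = 1" "cols x \<inter> cols y = {}"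
    using links by (simp_all add: row_linked_def col_linked_def Int_commute)
  then obtain u v u' v' where cols: "cols z = {u, v}" "cols x = {u, u'}" "cols y = {v, v'}" "distinct [u, v, u', v']"
    using path_ends[OF c(6,4,5)] by blast
  obtain w w' where z: "rows z = {w, w'}" "w \<noteq> w'" using two_elements[OF c(3)] .
  have "card (rows x \<inter> rows y) = 1" using links by (simp add: row_linked_def)
  then obtain p a b where xy: "rows x = {p, a}" "rows y = {p, b}" "distinct [p, a, b]"
    using meet_in_one[OF c(1,2)] by blast
  show False
    by (rule no_three_blocks[OF T xyz, of "[p, a, b, w, w']" "[R0, R1, R2, R3, R4]"
          "[u, u', v, v']" "[C0, C1, C2, C3]", OF _ _ _ _ _ _ _ _ _ impossible_col_path])
      (use links cols z xy rows_subset[of x] rows_subset[of y] rows_subset[of z]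
        cols_subset[of x] cols_subset[of y] cols_subset[of z] in \<open>auto simp: on_iff col_linked_def\<close>)
qed

theorem no_colouring: False
proof -
  obtain T where T: "T \<subseteq> doubles" "card T = 15"
    using many_doubles obtain_subset_with_card_n by metis
  obtain x y z where xyz: "x \<in> paired T" "y \<in> paired T" "z \<in> paired T"
    and ne: "\<not> (rows x = rows y \<and> cols x = cols y)" "\<not> (rows x = rows z \<and> cols x = cols z)"
      "\<not> (rows y = rows z \<and> cols y = cols z)"
    by (rule three_blocks[OF T])
  have link: "row_linked u v \<or> col_linked u v"
    if uv: "u \<in> paired T" "v \<in> paired T" "\<not> (rows u = rows v \<and> cols u = cols v)" for u v
  proof -
    obtain u' v' where "u' \<in> T" "twins u u'" "v' \<in> T" "twins v v'" using uv by (auto simp: paired_def)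
    then have "card (rows u \<inter> rows v) + card (cols u \<inter> cols v) = 1"
      using uv T by (intro blocks_share_one_line[of u u' v v']) (auto simp: paired_def)
    then have "card (rows u \<inter> rows v) = 1 \<and> card (cols u \<inter> cols v) = 0 \<or>
      card (rows u \<inter> rows v) = 0 \<and> card (cols u \<inter> cols v) = 1" by linarith
    then show ?thesis by (auto simp: row_linked_def col_linked_def)
  qed
  note triple = no_row_linked_triple[OF T] no_col_linked_triple[OF T] no_row_path[OF T] no_col_path[OF T]
  have "row_linked x y \<or> col_linked x y" "row_linked x z \<or> col_linked x z" "row_linked y z \<or> col_linked y z"
    using link xyz ne by blast+
  then consider "row_linked x y" "row_linked x z" "row_linked y z"
    | "row_linked x y" "row_linked x z" "col_linked y z"
    | "row_linked y x" "row_linked y z" "col_linked x z"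
    | "row_linked z x" "row_linked z y" "col_linked x y"
    | "row_linked x y" "col_linked x z" "col_linked y z"
    | "row_linked x z" "col_linked x y" "col_linked z y"
    | "row_linked y z" "col_linked y x" "col_linked z x"
    | "col_linked x y" "col_linked x z" "col_linked y z"
    using linked_commute by metis
  then show False
    by cases (use xyz triple in metis)+
qed

end

section \<open>The achromatic number\<close>

lemma pverts_product: "pverts (complete_graph m \<box> complete_graph n) = {..<m} \<times> {..<n}"
  by (simp add: complete_graph_def cartesian_product_def)

lemma parcs_product: "((i, j), (i', j')) \<in> parcs (complete_graph m \<box> complete_graph n) \<longleftrightarrow>
    i < m \<and> i' < m \<and> j < n \<and> j' < n \<and> (i = i' \<and> j \<noteq> j' \<or> i \<noteq> i' \<and> j = j')"
  by (auto simp: complete_graph_def cartesian_product_def)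

lemma colour_numbers_le_18:
  assumes "k \<in> colour_numbers (complete_graph 6 \<box> complete_graph 7)"
  shows "k \<le> 18"
proof (rule ccontr)
  assume "\<not> k \<le> 18"
  obtain C :: "nat set" and f where k: "k = card C" and C: "finite C"
    and range: "f \<in> {..<6} \<times> {..<7} \<rightarrow> C"
    and proper: "proper_colouring (complete_graph 6 \<box> complete_graph 7) f"
    and complete: "complete_colouring (complete_graph 6 \<box> complete_graph 7) C f"
    using assms unfolding colour_numbers_def pverts_product by blast
  have ne: "f (i, j) \<noteq> f (i', j')"
    if "((i, j), (i', j')) \<in> parcs (complete_graph 6 \<box> complete_graph 7)" for i j i' j'
    using proper that unfolding proper_colouring_def by blast
  interpret grid_colouring "\<lambda>i j. f (i, j)" C
  proof
    show "finite C" by (rule C)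
    show "f (i, j) \<in> C" if "i < 6" "j < 7" for i j using range that by auto
    show "j = j'" if "i < 6" "j < 7" "j' < 7" "f (i, j) = f (i, j')" for i j j'
      using ne[of i j i j'] that by (auto simp: parcs_product)
    show "i = i'" if "i < 6" "i' < 6" "j < 7" "f (i, j) = f (i', j)" for i i' j
      using ne[of i j i' j] that by (auto simp: parcs_product)
    show "(\<exists>i<6. \<exists>j<7. \<exists>j'<7. f (i, j) = x \<and> f (i, j') = y) \<or>
        (\<exists>j<7. \<exists>i<6. \<exists>i'<6. f (i, j) = x \<and> f (i', j) = y)"
      if xy: "x \<in> C" "y \<in> C" "x \<noteq> y" for x y
    proof -
      obtain p q where pq: "(p, q) \<in> parcs (complete_graph 6 \<box> complete_graph 7)" "f p = x" "f q = y"
        using complete xy unfolding complete_colouring_def by meson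
      obtain i j where p: "p = (i, j)" by (cases p)
      obtain i' j' where q: "q = (i', j')" by (cases q)
      show ?thesis using pq unfolding p q parcs_product by blast
    qed
    show "19 \<le> card C" using k \<open>\<not> k \<le> 18\<close> by simp
  qed
  show False by (rule no_colouring)
qed

text \<open>Columns \<open>0\<close> to \<open>5\<close> consist of nine blocks, indexed by \<open>i, j < 3\<close>.  The block \<open>(i, j)\<close> has the colours
\<open>2 (3 i + j)\<close> and \<open>2 (3 i + j) + 1\<close>, the rows \<open>i\<close> and \<open>3 + j\<close>, and the columns \<open>i + j\<close> and \<open>3 + (i - j)\<close>,
with \<open>i + j\<close> and \<open>i - j\<close> taken modulo 3.  Two blocks with the same \<open>i\<close> or the same \<open>j\<close> share a row; if
both indices differ, then the differences agree up to sign modulo 3, and the blocks share a column.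
The last column is filled without creating a repetition.\<close>
definition table :: "nat list list" where
  "table =
   [[ 0,  2,  4,  1,  5,  3,  6],
    [10,  6,  8,  9,  7, 11, 12],
    [14, 16, 12, 17, 15, 13,  0],
    [ 1,  7, 13,  0,  6, 12,  3],
    [15,  3,  9,  8, 14,  2,  5],
    [11, 17,  5, 16,  4, 10,  1]]"

definition table_lines :: "nat list list" where
  "table_lines = table @ map (\<lambda>j. map (\<lambda>row. row ! j) table) [0..<7]"

lemma table_shape: "length table = 6" "\<forall>row\<in>set table. length row = 7"
  by (simp_all add: table_def)

lemma table_lines_distinct: "\<forall>l\<in>set table_lines. distinct l"
  by (simp add: table_lines_def table_def upt_rec numeral_eq_Suc)

lemma table_range: "\<forall>row\<in>set table. \<forall>c\<in>set row. c < 18"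
  by (simp add: table_def)

lemma table_complete: "\<forall>x\<in>set [0..<18]. \<forall>y\<in>set [0..<18]. \<exists>l\<in>set table_lines. x \<in> set l \<and> y \<in> set l"
  by code_simp

lemma table_line_cases:
  assumes "l \<in> set table_lines"
  obtains i where "i < 6" "l = table ! i" | j where "j < 7" "l = map (\<lambda>row. row ! j) table"
  using assms table_shape(1) by (auto simp: table_lines_def in_set_conv_nth)

lemma colour_number_18: "18 \<in> colour_numbers (complete_graph 6 \<box> complete_graph 7)"
proof -
  define f where "f p = table ! fst p ! snd p" for p
  have row: "table ! i \<in> set table" "length (table ! i) = 7" if "i < 6" for i
    using that table_shape by auto
  have f_lt: "f (i, j) < 18" if "i < 6" "j < 7" for i j
    using row[OF that(1)] that table_range by (simp add: f_def)
  have "f (i, j) \<noteq> f (i', j')" if arc: "((i, j), (i', j')) \<in> parcs (complete_graph 6 \<box> complete_graph 7)" for i j i' j'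
  proof -
    have ij: "i < 6" "i' < 6" "j < 7" "j' < 7" using arc by (simp_all add: parcs_product)
    consider "i = i'" "j \<noteq> j'" | "i \<noteq> i'" "j = j'" using arc by (auto simp: parcs_product)
    then show ?thesis
    proof cases
      case 1
      have "distinct (table ! i)" using table_lines_distinct row[OF ij(1)] by (simp add: table_lines_def)
      then show ?thesis using 1 ij row[OF ij(1)] by (simp add: f_def nth_eq_iff_index_eq)
    next
      case 2
      have "map (\<lambda>row. row ! j) table \<in> set table_lines" using ij by (auto simp: table_lines_def)
      then have "distinct (map (\<lambda>row. row ! j) table)" using table_lines_distinct by blast
      then have "map (\<lambda>row. row ! j) table ! i \<noteq> map (\<lambda>row. row ! j) table ! i'"
        using 2 ij table_shape(1) by (subst nth_eq_iff_index_eq) auto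
      then show ?thesis using 2 ij table_shape(1) by (simp add: f_def)
    qed
  qed
  then have proper: "proper_colouring (complete_graph 6 \<box> complete_graph 7) f"
    unfolding proper_colouring_def by auto
  have "\<exists>u v. (u, v) \<in> parcs (complete_graph 6 \<box> complete_graph 7) \<and> f u = x \<and> f v = y"
    if xy: "x < 18" "y < 18" "x \<noteq> y" for x y
  proof -
    have "x \<in> set [0..<18]" "y \<in> set [0..<18]" using xy by simp_all
    then obtain l where l: "l \<in> set table_lines" "x \<in> set l" "y \<in> set l" using table_complete by blast
    from l(1) show ?thesis
    proof (cases rule: table_line_cases)
      case (1 i)
      then obtain j j' where "j < 7" "j' < 7" "table ! i ! j = x" "table ! i ! j' = y"
        using l row[OF 1(1)] by (auto simp: in_set_conv_nth)
      then show ?thesis using 1 xy by (intro exI[of _ "(i, j)"] exI[of _ "(i, j')"]) (auto simp: f_def parcs_product)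
    next
      case (2 j)
      then obtain i i' where "i < 6" "i' < 6" "table ! i ! j = x" "table ! i' ! j = y"
        using l table_shape(1) by (auto simp: in_set_conv_nth)
      then show ?thesis using 2 xy by (intro exI[of _ "(i, j)"] exI[of _ "(i', j)"]) (auto simp: f_def parcs_product)
    qed
  qed
  then have complete: "complete_colouring (complete_graph 6 \<box> complete_graph 7) {..<18} f"
    unfolding complete_colouring_def by auto
  have "f \<in> pverts (complete_graph 6 \<box> complete_graph 7) \<rightarrow> {..<18}"
    using f_lt by (auto simp: pverts_product)
  with proper complete have "card {..<18::nat} \<in> colour_numbers (complete_graph 6 \<box> complete_graph 7)"
    unfolding colour_numbers_def by blast
  then show ?thesis by simp
qed

theorem theorem3:
  shows "achr (complete_graph 6 \<box> complete_graph 7) = 18"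
  unfolding achr_def
  using colour_number_18 colour_numbers_le_18
    finite_colour_numbers[OF pair_graph_cartesian_product[OF pair_graph_complete_graph pair_graph_complete_graph]]
  by (intro Max_eqI) auto

end
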